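(* Let $\{a_n\}_{n\in\mathbb{N}}$ be any positive sequence with $$a_n\to\infty\qquad\text{and}\qquad\frac{a_n}{\sqrt{\log n}}\to0.$$ Then the rescaled random variables $$Y_n:=\frac{f_0(T_n)-\frac23\log n}{\sqrt{\frac{10}{27}}\;a_n\sqrt{\log n}}$$ satisfy a large deviation principle on $\mathbb{R}$ with speed $a_n^2$ and good rate function $I(x)=x^2/2$.
   Context: Let $T\subset\mathbb{R}^2$ be the triangle with vertices $(0,0)$, $\mathbf{v}_1=(1,0)$, $\mathbf{v}_2=(0,1)$. For $n\ge 0$ let $\mathbf{X}_1,\dots,\mathbf{X}_n$ be independent uniformly distributed random points in $T$ and $T_n:=\operatorname{conv}\{\mathbf{v}_1,\mathbf{v}_2,\mathbf{X}_1,\dots,\mathbf{X}_n\}$. $f_0(T_n)$ is the number of vertices of $T_n$ (including $\mathbf{v}_1,\mathbf{v}_2$). ($Y_n$ is considered for $n\ge2$.) A sequence of random variables $X_n$ satisfies a large deviation principle on $\mathbb{R}$ with speed $s_n$ and good rate function $I:\mathbb{R}\to[0,+\infty]$ if $s_n\ge0$ with $s_n\to\infty$; $I$ is lower semicontinuous and has compact level sets $\{x\in\mathbb{R}:I(x)\le c\}$ for every $c\ge0$; and for every Borel set $B\subseteq\mathbb{R}$, $$-\inf_{x\in\operatorname{int}(B)}I(x)\le\liminf_{n\to\infty}\frac1{s_n}\log\mathbb{P}(X_n\in B)\le\limsup_{n\to\infty}\frac1{s_n}\log\mathbb{P}(X_n\in B)\le-\inf_{x\in\operatorname{cl}(B)}I(x).$$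 *)

theory Defs
  imports "HOL-Probability.Probability"
begin

definition triangle_v1 :: "real \<times> real" where
  "triangle_v1 = (1, 0)"

definition triangle_v2 :: "real \<times> real" where
  "triangle_v2 = (0, 1)"

definition triangle_T :: "(real \<times> real) set" where
  "triangle_T = convex hull {(0, 0), triangle_v1, triangle_v2}"

definition T_hull :: "(nat \<Rightarrow> 'w \<Rightarrow> real \<times> real) \<Rightarrow> nat \<Rightarrow> 'w \<Rightarrow> (real \<times> real) set" where
  "T_hull X n \<omega> = convex hull ({triangle_v1, triangle_v2} \<union> (\<lambda>i. X i \<omega>) ` {1..n})"

definition num_vertices :: "'a::real_vector set \<Rightarrow> nat" where
  "num_vertices P = card {v. v extreme_point_of P}"

definition ln_ext :: "real \<Rightarrow> ereal" where
  "ln_ext p = (if p = 0 then - \<infinity> else ereal (ln p))"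

definition lower_semicontinuous :: "('a::topological_space \<Rightarrow> ereal) \<Rightarrow> bool" where
  "lower_semicontinuous f \<longleftrightarrow> (\<forall>x. f x \<le> Liminf (at x) f)"

definition good_rate_function :: "(real \<Rightarrow> ereal) \<Rightarrow> bool" where
  "good_rate_function I \<longleftrightarrow>
     (\<forall>x. 0 \<le> I x) \<and> lower_semicontinuous I \<and>
     (\<forall>c::real. c \<ge> 0 \<longrightarrow> compact {x. I x \<le> ereal c})"

text \<open>The infima over the interior and the closure are taken in the extended reals, so the
  infimum over the empty set is \<open>\<infinity>\<close>. Finitely many indices with \<open>s n = 0\<close>
  (where \<open>1 / s n\<close> is the junk value 0) do not matter, since \<open>s\<close> tends to infinity.\<close>

definition large_deviation_principle ::
  "'w measure \<Rightarrow> (nat \<Rightarrow> 'w \<Rightarrow> real) \<Rightarrow> (nat \<Rightarrow> real) \<Rightarrow> (real \<Rightarrow> ereal) \<Rightarrow> bool" where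
  "large_deviation_principle M Y s I \<longleftrightarrow>
     (\<forall>n. Y n \<in> borel_measurable M) \<and>
     (\<forall>n. 0 \<le> s n) \<and> filterlim s at_top sequentially \<and>
     good_rate_function I \<and>
     (\<forall>B \<in> sets borel.
        - (INF x\<in>interior B. I x)
          \<le> liminf (\<lambda>n. ereal (1 / s n) * ln_ext (measure M {\<omega> \<in> space M. Y n \<omega> \<in> B})) \<and>
        liminf (\<lambda>n. ereal (1 / s n) * ln_ext (measure M {\<omega> \<in> space M. Y n \<omega> \<in> B}))
          \<le> limsup (\<lambda>n. ereal (1 / s n) * ln_ext (measure M {\<omega> \<in> space M. Y n \<omega> \<in> B})) \<and>
        limsup (\<lambda>n. ereal (1 / s n) * ln_ext (measure M {\<omega> \<in> space M. Y n \<omega> \<in> B}))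
          \<le> - (INF x\<in>closure B. I x))"

text \<open>For \<open>n < 2\<close> the denominator is 0 and the value is the junk value 0;
  this does not affect a large deviation principle.\<close>

definition Y_rescaled ::
  "(nat \<Rightarrow> real) \<Rightarrow> (nat \<Rightarrow> 'w \<Rightarrow> real \<times> real) \<Rightarrow> nat \<Rightarrow> 'w \<Rightarrow> real" where
  "Y_rescaled a X n \<omega> =
     (real (num_vertices (T_hull X n \<omega>)) - 2 / 3 * ln (real n))
       / (sqrt (10 / 27) * a n * sqrt (ln (real n)))"

end

theory Submission
  imports Defs "HOL-Real_Asymp.Real_Asymp"
begin

text \<open>The number \<open>f\<^sub>0(T\<^sub>n)\<close> is controlled through its probability generating function
\<open>g\<^sub>n(z) = E z ^ f\<^sub>0(T\<^sub>n)\<close>, which satisfies the exact recurrence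
\<open>n (n + 1) g\<^sub>n(z) = 2 z (\<Sum>j<n. (n - j) g\<^sub>j(z))\<close> with \<open>g\<^sub>0(z) = z\<^sup>2\<close>.

The recurrence comes from splitting off the vertex \<open>V\<close> of \<open>T\<^sub>n\<close> next to \<open>(0, 1)\<close>. Write
\<open>V = (u r, 1 - r)\<close>: the ray from \<open>(0, 1)\<close> through \<open>V\<close> meets the horizontal axis in \<open>(u, 0)\<close>, and
\<open>r\<close> is the relative distance of \<open>V\<close> from \<open>(0, 1)\<close> on it. A uniform point of the triangle has
independent \<open>u\<close> and \<open>r\<close> with densities \<open>1\<close> and \<open>2 r\<close> on \<open>(0, 1)\<close>. The point \<open>V\<close> is the next
vertex exactly if all other points lie beyond this ray. Among those, the points in the triangle
\<open>V, (0, 1), (1, 0)\<close> are hidden behind \<open>V\<close>; the remaining vertices are those of the chain from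
\<open>V\<close> to \<open>(1, 0)\<close> spanned by the points in the triangle \<open>V, (u, 0), (1, 0)\<close>
(\<open>nverts_first_vertex\<close>). This triangle is an affine image of the original one and takes the
fraction \<open>1 - r\<close> of the area beyond the ray, so the conditional problem is a copy of the
original one with a binomial number of points (\<open>nn_integral_thinned\<close>). Integrating over \<open>u\<close> and
\<open>r\<close> leaves Beta integrals and hence the recurrence (\<open>nn_integral_vertex_weight\<close>).

Put \<open>2 z = (1 + p) (2 + p)\<close>. The recurrence implies for \<open>\<bar>p\<bar> < 1\<close> and \<open>n \<ge> 1\<close> that the quotient
\<open>g\<^sub>n\<^sub>+\<^sub>1(z) / g\<^sub>n(z)\<close> lies between \<open>1 + p / (n + 1)\<close> and \<open>1 / (1 - p / (n + 1))\<close>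
(\<open>chain_gf_ratio_bounds\<close>), so that \<open>ln (g\<^sub>n(z)) = p ln n + O(1)\<close> uniformly for \<open>\<bar>p\<bar> \<le> 1/2\<close>. For
\<open>z = exp \<theta>\<close> this gives \<open>p = (sqrt (1 + 8 exp \<theta>) - 3) / 2 = 2/3 \<theta> + 5/27 \<theta>\<^sup>2 + o(\<theta>\<^sup>2)\<close>; here the
centring \<open>2/3\<close> and the variance constant \<open>10/27 = 2 * 5/27\<close> appear. Choosing \<open>\<theta>\<close> of the order
\<open>a\<^sub>n / sqrt (ln n)\<close>, which tends to 0, the normalised cumulant generating functions of \<open>Y\<^sub>n\<close>
converge to \<open>l\<^sup>2 / 2\<close>, the error \<open>O(1)\<close> being negligible against the speed
(\<open>ln_chain_gf_asymp\<close>). For such a quadratic limit the upper bound of the large deviation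
principle follows from exponential tail bounds and the lower bound from exponential tilting
(\<open>gaertner_ellis_quadratic\<close>).\<close>

section \<open>Vertices of the convex hull of a finite planar set\<close>

definition exposed_points :: "'a::real_inner set \<Rightarrow> 'a set" where
  "exposed_points S = {v \<in> S. \<exists>c. \<forall>q \<in> S - {v}. c \<bullet> q < c \<bullet> v}"

text \<open>For finitely many points, separation of a point from a compact convex set makes every extreme
point the unique maximiser of a linear functional. Such functionals serve below as certificates,
both for comparing the vertices of different hulls and for measurability.\<close>
lemma extreme_points_finite_hull:
  fixes S :: "'a::euclidean_space set"
  assumes "finite S"
  shows "{v. v extreme_point_of (convex hull S)} = exposed_points S"
proof (intro equalityI subsetI)
  fix v assume "v \<in> {v. v extreme_point_of (convex hull S)}"
  then have ext: "v extreme_point_of (convex hull S)" by simp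
  have vS: "v \<in> S" by (rule extreme_point_of_convex_hull[OF ext])
  have "v \<notin> convex hull (S - {v})"
  proof
    assume "v \<in> convex hull (S - {v})"
    then have "convex hull (insert v (S - {v})) = convex hull (S - {v})" by (rule hull_redundant)
    then have "v extreme_point_of (convex hull (S - {v}))" using ext vS by (simp add: insert_absorb)
    from extreme_point_of_convex_hull[OF this] show False by simp
  qed
  moreover have "closed (convex hull (S - {v}))"
    using assms by (simp add: compact_convex_hull compact_imp_closed finite_imp_compact)
  ultimately obtain a b where ab: "a \<bullet> v < b" "\<forall>x \<in> convex hull (S - {v}). a \<bullet> x > b"
    using separating_hyperplane_closed_point[of "convex hull (S - {v})" v] by auto
  have "\<forall>q \<in> S - {v}. (-a) \<bullet> q < (-a) \<bullet> v"
    using ab hull_inc[of _ "S - {v}" convex] by fastforce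
  then show "v \<in> exposed_points S" using vS unfolding exposed_points_def by blast
next
  fix v assume "v \<in> exposed_points S"
  then obtain c where vS: "v \<in> S" and c: "\<forall>q \<in> S - {v}. c \<bullet> q < c \<bullet> v"
    by (auto simp: exposed_points_def)
  have "convex hull (S - {v}) \<subseteq> {q. c \<bullet> q < c \<bullet> v}"
    by (rule hull_minimal) (use c in \<open>auto simp: convex_halfspace_lt\<close>)
  then have "v \<notin> convex hull (S - {v})" by auto
  from extreme_point_of_convex_hull_insert[OF _ this] assms vS
  show "v \<in> {v. v extreme_point_of (convex hull S)}" by (simp add: insert_absorb)
qed

text \<open>The functionals with a given unique maximiser form an open set, so rational ones suffice. This
turns being a vertex into a countable combination of measurable conditions.\<close>
lemma exposed_points_rational:
  fixes S :: "(real \<times> real) set"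
  assumes "finite S"
  shows "v \<in> exposed_points S \<longleftrightarrow>
    v \<in> S \<and> (\<exists>a b :: rat. \<forall>q \<in> S - {v}. (of_rat a, of_rat b) \<bullet> q < (of_rat a, of_rat b) \<bullet> v)"
    (is "_ \<longleftrightarrow> v \<in> S \<and> ?R")
proof
  assume "v \<in> exposed_points S"
  then obtain c where vS: "v \<in> S" and c: "\<forall>q \<in> S - {v}. c \<bullet> q < c \<bullet> v"
    by (auto simp: exposed_points_def)
  define U where "U = (\<Inter>q \<in> S - {v}. {c. c \<bullet> q < c \<bullet> v})"
  have "open U" unfolding U_def
    using assms by (intro open_INT ballI open_Collect_less continuous_intros) auto
  moreover have "c \<in> U" using c by (auto simp: U_def)
  ultimately obtain A B where AB: "open A" "open B" "c \<in> A \<times> B" "A \<times> B \<subseteq> U"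
    by (rule open_prod_elim)
  have rat: "\<exists>r :: rat. of_rat r \<in> W" if "open W" "w \<in> W" for W :: "real set" and w
  proof -
    have "\<exists>e>0. ball w e \<subseteq> W" by (rule bspec[OF iffD1[OF open_contains_ball]]) (fact that)+
    then obtain e where e: "e > 0" "ball w e \<subseteq> W" by (elim exE conjE)
    obtain r :: rat where "w < of_rat r" "of_rat r < w + e" using of_rat_dense[of w "w + e"] e(1) by force
    then have "of_rat r \<in> ball w e" by (simp add: dist_real_def)
    then have "of_rat r \<in> W" using e(2) by (rule subsetD[rotated])
    then show ?thesis by (rule exI)
  qed
  obtain c1 c2 where "c = (c1, c2)" by (cases c)
  then obtain a b :: rat where "of_rat a \<in> A" "of_rat b \<in> B" using AB(3) rat[OF AB(1)] rat[OF AB(2)] by blast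
  then have "(of_rat a, of_rat b) \<in> U" using AB by blast
  then show "v \<in> S \<and> ?R" using vS by (auto simp: U_def)
qed (auto simp: exposed_points_def)

text \<open>The vertex count includes the endpoints \<open>(1, 0)\<close> and \<open>(0, 1)\<close> of the chain.\<close>
definition nverts :: "(real \<times> real) set \<Rightarrow> nat" where
  "nverts F = card (exposed_points ({(1, 0), (0, 1)} \<union> F))"

text \<open>Every point of a family with possible repetitions is counted at its first occurrence; this
writes a cardinality as a sum of indicators of measurable events even where sample points
coincide.\<close>
lemma card_image_eq_sum_first:
  fixes m :: nat
  shows "card {v \<in> y ` {..<m}. P v} = (\<Sum>k<m. if P (y k) \<and> (\<forall>l<k. y l \<noteq> y k) then 1 else 0 :: nat)"
proof -
  define K where "K = {k. k < m \<and> P (y k) \<and> (\<forall>l<k. y l \<noteq> y k)}"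
  have "inj_on y K" unfolding K_def by (rule inj_onI) (metis (mono_tags, lifting) linorder_neqE_nat mem_Collect_eq)
  moreover have "y ` K = {v \<in> y ` {..<m}. P v}"
  proof (intro equalityI subsetI)
    fix v assume "v \<in> {v \<in> y ` {..<m}. P v}"
    then obtain k where k: "k < m" "y k = v" "P v" by auto
    define l where "l = (LEAST l. y l = v)"
    have "y l = v" unfolding l_def by (rule LeastI) (rule k)
    moreover have "l \<le> k" unfolding l_def by (rule Least_le) (rule k)
    moreover have "\<forall>i<l. y i \<noteq> v" unfolding l_def using not_less_Least by blast
    ultimately have "l \<in> K" using k by (auto simp: K_def)
    then show "v \<in> y ` K" using \<open>y l = v\<close> by blast
  qed (auto simp: K_def)
  ultimately have "card {v \<in> y ` {..<m}. P v} = card K" by (metis card_image)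
  also have "\<dots> = (\<Sum>k<m. if P (y k) \<and> (\<forall>l<k. y l \<noteq> y k) then 1 else 0 :: nat)"
  proof -
    have "K = {k \<in> {..<m}. P (y k) \<and> (\<forall>l<k. y l \<noteq> y k)}" by (auto simp: K_def)
    then show ?thesis by (simp add: sum.If_cases) (simp add: Int_def)
  qed
  finally show ?thesis .
qed

lemma measurable_card_exposed_points:
  fixes y :: "nat \<Rightarrow> 'w \<Rightarrow> real \<times> real"
  assumes y: "\<And>k. k < m \<Longrightarrow> y k \<in> borel_measurable N"
  shows "(\<lambda>\<omega>. card (exposed_points ((\<lambda>k. y k \<omega>) ` {..<m}))) \<in> measurable N (count_space UNIV)"
proof -
  define w where "w k = (if k < m then y k else (\<lambda>_. 0))" for k
  have [measurable]: "w k \<in> borel_measurable N" for k using y by (auto simp: w_def)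
  let ?E = "\<lambda>\<omega> k. \<exists>a b :: rat. \<forall>l<m. w l \<omega> = w k \<omega> \<or> (of_rat a, of_rat b) \<bullet> w l \<omega> < (of_rat a, of_rat b) \<bullet> w k \<omega>"
  have im: "(\<lambda>k. y k \<omega>) ` {..<m} = (\<lambda>k. w k \<omega>) ` {..<m}" for \<omega> by (auto simp: w_def)
  have *: "card (exposed_points ((\<lambda>k. y k \<omega>) ` {..<m}))
     = (\<Sum>k<m. if ?E \<omega> k \<and> (\<forall>l<k. w l \<omega> \<noteq> w k \<omega>) then 1 else 0 :: nat)" for \<omega>
  proof -
    let ?S = "(\<lambda>k. w k \<omega>) ` {..<m}"
    define P where "P v \<longleftrightarrow> (\<exists>a b :: rat. \<forall>q \<in> ?S - {v}. (of_rat a, of_rat b) \<bullet> q < (of_rat a, of_rat b) \<bullet> v)" for v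
    have "v \<in> exposed_points ?S \<longleftrightarrow> v \<in> ?S \<and> P v" for v
      unfolding P_def by (rule exposed_points_rational) simp
    then have "exposed_points ?S = {v \<in> ?S. P v}" by blast
    moreover have "P (w k \<omega>) \<longleftrightarrow> ?E \<omega> k" if "k < m" for k
      unfolding P_def by (rule ex_cong1, rule ex_cong1) auto
    ultimately show ?thesis unfolding im by (simp only: card_image_eq_sum_first) (rule sum.cong, auto)
  qed
  show ?thesis unfolding * by measurable
qed

lemma measurable_nverts:
  assumes fin: "finite I" "finite P" and y: "\<And>i. i \<in> I \<Longrightarrow> y i \<in> borel_measurable N"
  shows "(\<lambda>\<omega>. nverts (P \<union> (\<lambda>i. y i \<omega>) ` I)) \<in> measurable N (count_space UNIV)"
proof -
  define Q where "Q = {(1, 0), (0, 1)} \<union> P"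
  obtain qs where qs: "set qs = Q" using fin finite_list[of Q] by (auto simp: Q_def)
  obtain js where js: "set js = I" using fin finite_list by blast
  define m where "m = length qs + length js"
  define x where "x k = (if k < length qs then (\<lambda>_. qs ! k) else y (js ! (k - length qs)))" for k
  have "(\<lambda>\<omega>. card (exposed_points ((\<lambda>k. x k \<omega>) ` {..<m}))) \<in> measurable N (count_space UNIV)"
  proof (rule measurable_card_exposed_points)
    fix k assume "k < m"
    then show "x k \<in> borel_measurable N" using js y by (auto simp: x_def m_def)
  qed
  moreover have "(\<lambda>k. x k \<omega>) ` {..<m} = {(1, 0), (0, 1)} \<union> (P \<union> (\<lambda>i. y i \<omega>) ` I)" for \<omega>
  proof -
    have "(\<lambda>j. j + length qs) ` {..<length js} = {length qs..<m}"
      using image_add_atLeastLessThan'[of "length qs" 0 "length js"] by (simp add: m_def atLeast0LessThan add.commute)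
    then have "{..<m} = {..<length qs} \<union> (\<lambda>j. j + length qs) ` {..<length js}"
      by (auto simp: m_def)
    then have "(\<lambda>k. x k \<omega>) ` {..<m} = (\<lambda>k. qs ! k) ` {..<length qs} \<union> (\<lambda>j. y (js ! j) \<omega>) ` {..<length js}"
      by (auto simp: x_def image_Un image_image)
    also have "(\<lambda>k. qs ! k) ` {..<length qs} = Q" using qs by (auto simp: set_conv_nth)
    also have "(\<lambda>j. y (js ! j) \<omega>) ` {..<length js} = (\<lambda>i. y i \<omega>) ` I" using js by (auto simp: set_conv_nth)
    finally show ?thesis by (simp add: Q_def Un_assoc)
  qed
  ultimately show ?thesis unfolding nverts_def by simp
qed

section \<open>Splitting off the first vertex of the chain\<close>

text \<open>The interior of the triangle: almost surely all points of the sample lie in it, and points of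
the boundary would only create degenerate cases.\<close>
definition open_triangle :: "(real \<times> real) set" where
  "open_triangle = {p. 0 < fst p \<and> 0 < snd p \<and> fst p + snd p < 1}"

text \<open>The affine map that takes the triangle with the vertices \<open>(u r, 1 - r)\<close>, \<open>(u, 0)\<close>, \<open>(1, 0)\<close> to
the one with the vertices \<open>(0, 1)\<close>, \<open>(0, 0)\<close>, \<open>(1, 0)\<close>, in this order.\<close>
definition chain_map :: "real \<Rightarrow> real \<Rightarrow> real \<times> real \<Rightarrow> real \<times> real" where
  "chain_map u r p = ((fst p - u + u * snd p) / (1 - u), snd p / (1 - r))"

lemma chain_map_in_triangle_iff:
  assumes u: "0 < u" "u < 1" and r: "0 < r" "r < 1"
  shows "chain_map u r p \<in> open_triangle \<longleftrightarrow>
    0 < snd p \<and> u * (1 - snd p) < fst p \<and> (1 - u * r) * snd p < (1 - r) * (1 - fst p)"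
proof -
  define x y where "x = fst p" and "y = snd p"
  have "chain_map u r p \<in> open_triangle \<longleftrightarrow>
      0 < y \<and> 0 < x - u + u * y \<and> (x - u + u * y) / (1 - u) + y / (1 - r) < 1"
    using u r by (auto simp: open_triangle_def chain_map_def x_def y_def zero_less_divide_iff)
  also have "(x - u + u * y) / (1 - u) + y / (1 - r) < 1 \<longleftrightarrow>
      ((x - u + u * y) / (1 - u) + y / (1 - r)) * ((1 - u) * (1 - r)) < 1 * ((1 - u) * (1 - r))"
    by (rule mult_less_cancel_right_pos[symmetric]) (use u r in auto)
  also have "((x - u + u * y) / (1 - u) + y / (1 - r)) * ((1 - u) * (1 - r))
      = (x - u + u * y) / (1 - u) * (1 - u) * (1 - r) + y / (1 - r) * (1 - r) * (1 - u)"
    by (simp add: distrib_right)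
  also have "\<dots> = (x - u + u * y) * (1 - r) + y * (1 - u)" using u r by simp
  also have "(x - u + u * y) * (1 - r) + y * (1 - u) < 1 * ((1 - u) * (1 - r)) \<longleftrightarrow> (1 - u * r) * y < (1 - r) * (1 - x)"
    by (simp add: algebra_simps)
  also have "0 < x - u + u * y \<longleftrightarrow> u * (1 - y) < x" by (simp add: algebra_simps)
  finally show ?thesis by (simp add: x_def y_def)
qed

lemma chain_map_in_triangleD:
  assumes u: "0 < u" "u < 1" and r: "0 < r" "r < 1" and p: "chain_map u r p \<in> open_triangle"
  shows "u * (1 - snd p) < fst p" "p \<in> open_triangle"
proof -
  define x y where "x = fst p" and "y = snd p"
  have 1: "0 < y" "u * (1 - y) < x" "(1 - u * r) * y < (1 - r) * (1 - x)"
    using p chain_map_in_triangle_iff[OF u r] by (auto simp: x_def y_def)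
  have "(1 - r) * y \<le> (1 - u * r) * y" using u r 1 by (intro mult_right_mono) auto
  then have "(1 - r) * (x + y) < (1 - r) * 1" using 1 by (simp add: algebra_simps)
  then have 2: "x + y < 1" using r by (simp add: mult_less_cancel_left)
  have "(1 - u) * y < 1 - u" using 1 2 by (simp add: algebra_simps)
  then have "y < 1" using u by (simp add: mult_less_cancel_left)
  then have "0 < u * (1 - y)" using u by simp
  then have "0 < x" using 1 by linarith
  then show "u * (1 - snd p) < fst p" "p \<in> open_triangle" using 1 2 by (auto simp: x_def y_def open_triangle_def)
qed

text \<open>Linear functionals correspond to each other under the affine map up to an additive constant, so
unique maximisers are preserved.\<close>
lemma chain_map_inner:
  assumes "u < 1" "r < 1"
  shows "d \<bullet> p = ((1 - u) * fst d, (1 - r) * (snd d - u * fst d)) \<bullet> chain_map u r p + u * fst d"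
proof -
  have "(1 - u) * fst d * ((fst p - u + u * snd p) / (1 - u)) = fst d * (fst p - u + u * snd p)"
    and "(1 - r) * (snd d - u * fst d) * (snd p / (1 - r)) = (snd d - u * fst d) * snd p"
    using assms by auto
  then show ?thesis by (simp add: inner_prod_def chain_map_def algebra_simps)
qed

lemma card_exposed_points_chain_map:
  assumes u: "u < 1" and r: "r < 1"
  shows "card (exposed_points (chain_map u r ` S)) = card (exposed_points S)"
proof -
  let ?f = "chain_map u r"
  have inj: "inj ?f"
  proof (rule injI)
    fix p q assume "?f p = ?f q"
    then have "d \<bullet> p = d \<bullet> q" for d using chain_map_inner[OF u r, of d p] chain_map_inner[OF u r, of d q] by simp
    then show "p = q" by (metis vector_eq_rdot inner_commute)
  qed
  have "?f p \<in> exposed_points (?f ` S) \<longleftrightarrow> p \<in> exposed_points S" for p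
  proof -
    have "(\<exists>c. \<forall>q \<in> S - {p}. c \<bullet> ?f q < c \<bullet> ?f p) \<longleftrightarrow> (\<exists>d. \<forall>q \<in> S - {p}. d \<bullet> q < d \<bullet> p)" (is "?L \<longleftrightarrow> ?R")
    proof
      assume ?L
      then obtain c where c: "\<forall>q \<in> S - {p}. c \<bullet> ?f q < c \<bullet> ?f p" by blast
      define d where "d = (fst c / (1 - u), u * fst c / (1 - u) + snd c / (1 - r))"
      have "c = ((1 - u) * fst d, (1 - r) * (snd d - u * fst d))" using u r by (auto simp: d_def prod_eq_iff)
      then have "\<forall>q \<in> S - {p}. d \<bullet> q < d \<bullet> p" using c chain_map_inner[OF u r, of d] by simp
      then show ?R by blast
    next
      assume ?R
      then obtain d where d: "\<forall>q \<in> S - {p}. d \<bullet> q < d \<bullet> p" by blast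
      then have "\<forall>q \<in> S - {p}. ((1 - u) * fst d, (1 - r) * (snd d - u * fst d)) \<bullet> ?f q < ((1 - u) * fst d, (1 - r) * (snd d - u * fst d)) \<bullet> ?f p"
        by (simp add: chain_map_inner[OF u r, of d])
      then show ?L by blast
    qed
    moreover have "?f ` S - {?f p} = ?f ` (S - {p})" using image_set_diff[OF inj, of S "{p}"] by simp
    ultimately show ?thesis using inj by (simp add: exposed_points_def inj_image_mem_iff)
  qed
  moreover have "exposed_points (?f ` S) \<subseteq> ?f ` S" by (auto simp: exposed_points_def)
  ultimately have "exposed_points (?f ` S) = ?f ` exposed_points S" by blast
  then show ?thesis using inj by (metis card_image inj_on_subset subset_UNIV)
qed

text \<open>The linear relation between \<open>(0, 1)\<close>, \<open>(x, y)\<close>, \<open>V = (u r, 1 - r)\<close> and \<open>(1, 0)\<close>, whose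
coefficients have the same sum on both sides. For a point \<open>(x, y)\<close> of the open triangle beyond
the ray through \<open>V\<close> both coefficients on the right are positive, and the sign of the first one
on the left tells on which side of the line through \<open>V\<close> and \<open>(1, 0)\<close> the point \<open>(x, y)\<close> lies.\<close>
lemma first_vertex_barycentric:
  fixes u r x y :: real and c :: "real \<times> real"
  shows "((1 - r) * (1 - x) - (1 - u * r) * y) * (c \<bullet> (0, 1)) + r * (1 - u) * (c \<bullet> (x, y))
    = (1 - x - y) * (c \<bullet> (u * r, 1 - r)) + r * (x - u * (1 - y)) * (c \<bullet> (1, 0))"
  by (cases c) (simp add: algebra_simps)

text \<open>The geometric core. The point \<open>V = (u r, 1 - r)\<close> is a vertex since all other points lie beyond
the ray through it. A point on or above the line from \<open>V\<close> to \<open>(1, 0)\<close> is a convex combination of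
\<open>V\<close>, \<open>(1, 0)\<close> and \<open>(0, 1)\<close> and no vertex. For a point \<open>x\<close> below this line, the segment from \<open>x\<close>
to \<open>(0, 1)\<close> crosses the segment from \<open>V\<close> to \<open>(1, 0)\<close>; hence a functional that is larger in \<open>x\<close>
than in \<open>V\<close> and \<open>(1, 0)\<close> is also larger in \<open>x\<close> than in \<open>(0, 1)\<close>, and dropping \<open>(0, 1)\<close> does not
affect which of these points are vertices.\<close>
lemma nverts_first_vertex:
  assumes u: "0 < u" "u < 1" and r: "0 < r" "r < 1"
    and Q: "finite Q" "Q \<subseteq> open_triangle" "\<And>q. q \<in> Q \<Longrightarrow> u * (1 - snd q) < fst q"
  shows "nverts (insert (u * r, 1 - r) Q)
    = Suc (nverts (chain_map u r ` {q \<in> Q. chain_map u r q \<in> open_triangle}))"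
proof -
  define V where "V = (u * r, 1 - r)"
  define Q' where "Q' = {q \<in> Q. chain_map u r q \<in> open_triangle}"
  define S where "S = {(1, 0), (0, 1)} \<union> insert V Q"
  define S' where "S' = {(1, 0), V} \<union> Q'"
  define A where "A q = (1 - r) * (1 - fst q) - (1 - u * r) * snd q" for q :: "real \<times> real"
  have ur: "0 < u * r" "u * r < u" using u r mult_strict_left_mono[of r 1 u] by (simp_all add: mult_pos_pos)
  then have "u * r < 1" using u by linarith
  note ur = ur this
  have Qt: "0 < fst q" "0 < snd q" "fst q + snd q < 1" if "q \<in> Q" for q
    using Q(2) that by (auto simp: open_triangle_def)
  have Q': "q \<in> Q' \<longleftrightarrow> 0 < A q" if "q \<in> Q" for q
    using chain_map_in_triangle_iff[OF u r, of q] Q(3)[OF that] Qt[OF that] that by (auto simp: Q'_def A_def)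
  have bary: "A q * (c \<bullet> (0, 1)) + r * (1 - u) * (c \<bullet> q)
      = (1 - fst q - snd q) * (c \<bullet> V) + r * (fst q - u * (1 - snd q)) * (c \<bullet> (1, 0))" for c q
    using first_vertex_barycentric[of r "fst q" u "snd q" c] by (simp add: A_def V_def)
  have wsum: "A q + r * (1 - u) = (1 - fst q - snd q) + r * (fst q - u * (1 - snd q))" for q
    by (simp add: A_def algebra_simps)
  have SS: "S' \<subseteq> S" by (auto simp: S_def S'_def Q'_def)
  have disj: "V \<notin> Q" "V \<noteq> (1, 0)" "V \<noteq> (0, 1)" "(1, 0) \<notin> Q" "(0, 1) \<notin> Q"
    using Q(3) Qt r u ur by (force simp: V_def algebra_simps)+
  have inside: "c \<bullet> q < M"
    if q: "q \<in> Q - Q'" and c: "c \<bullet> V < M" "c \<bullet> (1, 0) < M" "c \<bullet> (0, 1) < M" for c q M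
  proof -
    have "A q \<le> 0" using q Q'[of q] by auto
    have "r * (1 - u) * (c \<bullet> q) = (1 - fst q - snd q) * (c \<bullet> V) + r * (fst q - u * (1 - snd q)) * (c \<bullet> (1, 0)) + (- A q) * (c \<bullet> (0, 1))"
      using bary[of q c] by simp
    also have "\<dots> < (1 - fst q - snd q) * M + r * (fst q - u * (1 - snd q)) * M + (- A q) * M"
      using Qt[of q] Q(3)[of q] q c \<open>A q \<le> 0\<close> r
      by (intro add_less_le_mono mult_strict_left_mono mult_left_mono) (auto intro!: add_less_le_mono mult_strict_left_mono mult_left_mono)
    also have "\<dots> = (A q + r * (1 - u) - A q) * M" unfolding wsum by (simp add: algebra_simps)
    finally show ?thesis using r u by (simp add: mult_less_cancel_left)
  qed
  have top: "(0, 1) \<in> exposed_points S"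
  proof -
    have "\<forall>q \<in> S - {(0, 1)}. (0, 1) \<bullet> q < (0, 1) \<bullet> ((0, 1) :: real \<times> real)"
      using Qt r by (force simp: S_def V_def)
    then show ?thesis unfolding exposed_points_def S_def by blast
  qed
  have "x \<in> exposed_points S" if x: "x \<in> exposed_points S'" for x
  proof -
    obtain c where xS: "x \<in> S'" and c: "\<And>q. q \<in> S' \<Longrightarrow> q \<noteq> x \<Longrightarrow> c \<bullet> q < c \<bullet> x"
      using x by (auto simp: exposed_points_def)
    have "\<exists>c. \<forall>q \<in> S - {x}. c \<bullet> q < c \<bullet> x"
    proof -
      consider "x = (1, 0)" | "x = V" | "x \<in> Q'" using xS by (auto simp: S'_def)
      then show ?thesis
      proof cases
        case 1
        have "\<forall>q \<in> S - {x}. (1, 0) \<bullet> q < (1, 0) \<bullet> x"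
          using Qt ur by (force simp: S_def V_def 1)
        then show ?thesis by blast
      next
        case 2
        let ?h = "\<lambda>q. fst q + u * snd q - u"
        \<comment> \<open>The functional that is constant along the ray is maximal at \<open>(0, 1)\<close> as well; tilting it by the smallest gap singles out \<open>V\<close>.\<close>
        define m where "m = Min (?h ` insert (1, 0) Q)"
        have m: "m \<le> ?h q" if "q \<in> insert (1, 0) Q" for q
          unfolding m_def by (rule Min_le) (use Q that in auto)
        have "m \<in> ?h ` insert (1, 0) Q" unfolding m_def by (rule Min_in) (use Q in auto)
        then have "m > 0" using Q(3) u by (auto simp: algebra_simps)
        have less: "- fst q - (u + m) * snd q < - (u * r) - (u + m) * (1 - r)" if "q \<in> insert (1, 0) Q" for q
        proof -
          have "0 \<le> snd q"
          proof (cases "q = (1, 0)")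
            case False
            then show ?thesis using that Qt(2)[of q] by simp
          qed simp
          then have "0 \<le> m * snd q" using \<open>m > 0\<close> by simp
          moreover have "0 < m * r" using \<open>m > 0\<close> r by simp
          ultimately show ?thesis using m[OF that] by (simp add: algebra_simps)
        qed
        have "\<forall>q \<in> S - {x}. (-1, - (u + m)) \<bullet> q < (-1, - (u + m)) \<bullet> x"
        proof
          fix q assume "q \<in> S - {x}"
          then consider "q = (0, 1)" | "q \<in> insert (1, 0) Q" by (auto simp: S_def 2)
          then show "(-1, - (u + m)) \<bullet> q < (-1, - (u + m)) \<bullet> x"
          proof cases
            case 1
            have "0 < m * r" using \<open>m > 0\<close> r by simp
            then show ?thesis by (simp add: 1 2 V_def algebra_simps)
          next
            case q: 2
            then show ?thesis using less[OF q] by (simp add: 2 V_def inner_prod_def algebra_simps)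
          qed
        qed
        then show ?thesis by blast
      next
        case 3
        then have xQ: "x \<in> Q" and A: "0 < A x" using Q'[of x] by (auto simp: Q'_def)
        have cV: "c \<bullet> V < c \<bullet> x" and c1: "c \<bullet> (1, 0) < c \<bullet> x"
          using c[of V] c[of "(1, 0)"] disj xQ by (auto simp: S'_def)
        have "A x * (c \<bullet> (0, 1)) + r * (1 - u) * (c \<bullet> x)
          = (1 - fst x - snd x) * (c \<bullet> V) + r * (fst x - u * (1 - snd x)) * (c \<bullet> (1, 0))" by (rule bary)
        also have "\<dots> < (1 - fst x - snd x) * (c \<bullet> x) + r * (fst x - u * (1 - snd x)) * (c \<bullet> x)"
          using Qt[OF xQ] Q(3)[OF xQ] cV c1 r by (intro add_strict_mono mult_strict_left_mono) auto
        also have "\<dots> = A x * (c \<bullet> x) + r * (1 - u) * (c \<bullet> x)"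
          unfolding distrib_right[symmetric] wsum ..
        finally have c0: "c \<bullet> (0, 1) < c \<bullet> x" using A by (simp add: mult_less_cancel_left)
        have "c \<bullet> q < c \<bullet> x" if qS: "q \<in> S - {x}" for q
        proof -
          consider "q = (0, 1)" | "q \<in> S'" | "q \<in> Q - Q'" using qS by (auto simp: S_def S'_def)
          then show ?thesis using c0 c inside[OF _ cV c1 c0] qS by cases auto
        qed
        then show ?thesis by blast
      qed
    qed
    then show ?thesis using xS SS unfolding exposed_points_def by blast
  qed
  moreover have "x \<in> exposed_points S'" if x: "x \<in> exposed_points S" "x \<noteq> (0, 1)" for x
  proof -
    obtain c where xS: "x \<in> S" and c: "\<And>q. q \<in> S \<Longrightarrow> q \<noteq> x \<Longrightarrow> c \<bullet> q < c \<bullet> x"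
      using x by (auto simp: exposed_points_def)
    have "x \<in> S'"
    proof (rule ccontr)
      assume "x \<notin> S'"
      then have xQ: "x \<in> Q - Q'" using x xS by (auto simp: S_def S'_def)
      have "c \<bullet> x < c \<bullet> x"
        by (rule inside[OF xQ]) (use xQ disj c[of V] c[of "(1, 0)"] c[of "(0, 1)"] in \<open>auto simp: S_def\<close>)
      then show False by simp
    qed
    moreover have "\<forall>q \<in> S' - {x}. c \<bullet> q < c \<bullet> x" using c SS by blast
    ultimately show ?thesis unfolding exposed_points_def by blast
  qed
  ultimately have "exposed_points S = insert (0, 1) (exposed_points S')" using top by blast
  moreover have "(0, 1) \<notin> exposed_points S'" using disj by (auto simp: exposed_points_def S'_def Q'_def)
  moreover have "finite (exposed_points S')" using Q by (simp add: exposed_points_def S'_def Q'_def)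
  ultimately have "card (exposed_points S) = Suc (card (exposed_points S'))" by simp
  also have "card (exposed_points S') = card (exposed_points (chain_map u r ` S'))"
    by (rule card_exposed_points_chain_map[symmetric]) (use u r in auto)
  also have "chain_map u r ` S' = {(1, 0), (0, 1)} \<union> chain_map u r ` Q'"
  proof -
    have "u * r - u + u * (1 - r) = 0" by (simp add: algebra_simps)
    then have "chain_map u r V = (0, 1)" using r by (simp add: V_def chain_map_def)
    moreover have "chain_map u r (1, 0) = (1, 0)" using u by (simp add: chain_map_def)
    ultimately show ?thesis by (simp add: S'_def)
  qed
  finally show ?thesis by (simp add: nverts_def S_def V_def Q'_def)
qed

section \<open>The uniform distribution on the triangle\<close>

lemma nn_integral_Beta_nat:
  "(\<integral>\<^sup>+t. indicator {0<..<1} t * ennreal (t ^ a * (1 - t) ^ b) \<partial>lborel) = ennreal (fact a * fact b / fact (a + b + 1))"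
proof -
  have "((\<lambda>t. t powr (real a + 1 - 1) * (1 - t) powr (real b + 1 - 1)) has_integral Beta (real a + 1) (real b + 1)) {0<..<1}"
    using has_integral_Beta_real[of "real a + 1" "real b + 1"] by (simp add: has_integral_Icc_iff_Ioo)
  moreover have "Beta (real a + 1) (real b + 1) = fact a * fact b / fact (a + b + 1)"
    using Gamma_fact[of a, where ?'a = real] Gamma_fact[of b, where ?'a = real] Gamma_fact[of "a + b + 1", where ?'a = real]
    by (simp add: Beta_def add_ac)
  moreover have "t powr (real a + 1 - 1) * (1 - t) powr (real b + 1 - 1) = t ^ a * (1 - t) ^ b" if "t \<in> {0<..<1}" for t :: real
    using that by (simp add: powr_realpow)
  ultimately have I: "((\<lambda>t. t ^ a * (1 - t) ^ b) has_integral fact a * fact b / fact (a + b + 1)) {0<..<1::real}"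
    by (metis (no_types, lifting) has_integral_cong)
  have "0 \<le> t ^ a * (1 - t) ^ b" if "t \<in> {0<..<1}" for t :: real using that by simp
  from nn_integral_has_integral_lebesgue'[OF this I] show ?thesis by (simp add: mult.commute)
qed

lemma sets_open_triangle [measurable]: "open_triangle \<in> sets borel"
  unfolding open_triangle_def
  by (intro borel_open open_Collect_conj open_Collect_less continuous_intros)

lemma nn_integral_lborel_plane:
  fixes g :: "real \<times> real \<Rightarrow> ennreal"
  assumes "g \<in> borel_measurable borel"
  shows "(\<integral>\<^sup>+p. g p \<partial>lborel) = (\<integral>\<^sup>+y. \<integral>\<^sup>+x. g (x, y) \<partial>lborel \<partial>lborel)"
proof -
  have "g \<in> borel_measurable (lborel \<Otimes>\<^sub>M lborel)" unfolding lborel_prod using assms by simp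
  from lborel_pair.nn_integral_snd[OF this] show ?thesis by (simp add: lborel_prod)
qed

text \<open>The polar-like coordinates \<open>(u r, 1 - r)\<close> around the corner \<open>(0, 1)\<close>, with Jacobian \<open>r\<close>.\<close>
lemma nn_integral_open_triangle:
  assumes [measurable]: "f \<in> borel_measurable borel"
  shows "(\<integral>\<^sup>+p. indicator open_triangle p * f p \<partial>lborel) =
    (\<integral>\<^sup>+r. indicator {0<..<1} r * (ennreal r * (\<integral>\<^sup>+u. indicator {0<..<1} u * f (u * r, 1 - r) \<partial>lborel)) \<partial>lborel)"
proof -
  define g where "g p = indicator open_triangle p * f p" for p
  have [measurable]: "g \<in> borel_measurable borel" unfolding g_def by measurable
  have "(\<integral>\<^sup>+p. g p \<partial>lborel) = (\<integral>\<^sup>+y. \<integral>\<^sup>+x. g (x, y) \<partial>lborel \<partial>lborel)"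
    by (rule nn_integral_lborel_plane) measurable
  also have "\<dots> = \<bar>-1::real\<bar> * (\<integral>\<^sup>+r. \<integral>\<^sup>+x. g (x, 1 + -1 * r) \<partial>lborel \<partial>lborel)"
    by (rule nn_integral_real_affine) simp_all
  also have "\<dots> = (\<integral>\<^sup>+r. \<integral>\<^sup>+x. g (x, 1 - r) \<partial>lborel \<partial>lborel)" by simp
  also have "\<dots> = (\<integral>\<^sup>+r. indicator {0<..<1} r * (ennreal r * (\<integral>\<^sup>+u. indicator {0<..<1} u * f (u * r, 1 - r) \<partial>lborel)) \<partial>lborel)"
  proof (rule nn_integral_cong)
    fix r :: real
    show "(\<integral>\<^sup>+x. g (x, 1 - r) \<partial>lborel) = indicator {0<..<1} r * (ennreal r * (\<integral>\<^sup>+u. indicator {0<..<1} u * f (u * r, 1 - r) \<partial>lborel))"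
    proof (cases "0 < r \<and> r < 1")
      case True
      have "(\<integral>\<^sup>+x. g (x, 1 - r) \<partial>lborel) = \<bar>r\<bar> * (\<integral>\<^sup>+u. g (0 + r * u, 1 - r) \<partial>lborel)"
        by (rule nn_integral_real_affine) (use True in simp_all)
      moreover have "g (0 + r * u, 1 - r) = indicator {0<..<1} u * f (u * r, 1 - r)" for u
        using True by (auto simp: g_def open_triangle_def mult.commute zero_less_mult_iff split: split_indicator)
      ultimately show ?thesis using True by simp
    next
      case False
      then have "g (x, 1 - r) = 0" for x by (auto simp: g_def open_triangle_def split: split_indicator)
      then show ?thesis using False by simp
    qed
  qed
  finally show ?thesis by (simp add: g_def)
qed

lemma triangle_T_eq: "triangle_T = {p. 0 \<le> fst p \<and> 0 \<le> snd p \<and> fst p + snd p \<le> 1}"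
proof (intro equalityI subsetI)
  fix p :: "real \<times> real" assume "p \<in> {p. 0 \<le> fst p \<and> 0 \<le> snd p \<and> fst p + snd p \<le> 1}"
  then have "p = (1 - fst p - snd p) *\<^sub>R (0, 0) + fst p *\<^sub>R (1, 0) + snd p *\<^sub>R (0, 1) \<and> 0 \<le> 1 - fst p - snd p
    \<and> 0 \<le> fst p \<and> 0 \<le> snd p \<and> (1 - fst p - snd p) + fst p + snd p = 1"
    by (auto simp: prod_eq_iff)
  then show "p \<in> triangle_T"
    unfolding triangle_T_def triangle_v1_def triangle_v2_def convex_hull_3 by blast
qed (auto simp: triangle_T_def triangle_v1_def triangle_v2_def convex_hull_3)

lemma AE_triangle_T: "AE p in lborel. p \<in> triangle_T \<longleftrightarrow> p \<in> open_triangle"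
proof -
  have h: "AE p in lborel. a \<bullet> p \<noteq> b" if "a \<noteq> 0" for a :: "real \<times> real" and b
  proof -
    have "{x. a \<bullet> x = b} \<in> null_sets lebesgue"
      using negligible_hyperplane[of a b] that by (simp add: negligible_iff_null_sets)
    then have "AE p in lebesgue. p \<notin> {x. a \<bullet> x = b}" by (rule AE_not_in)
    then show ?thesis by (simp add: AE_completion_iff)
  qed
  have "AE p :: real \<times> real in lborel. (1, 0) \<bullet> p \<noteq> 0" "AE p :: real \<times> real in lborel. (0, 1) \<bullet> p \<noteq> 0"
    "AE p :: real \<times> real in lborel. (1, 1) \<bullet> p \<noteq> 1"
    using h[of "(1, 0)" 0] h[of "(0, 1)" 0] h[of "(1, 1)" 1] by (simp_all add: zero_prod_def)
  then show ?thesis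
    by eventually_elim (auto simp: triangle_T_eq open_triangle_def inner_prod_def)
qed

lemma sets_triangle_T [measurable]: "triangle_T \<in> sets borel"
  unfolding triangle_T_eq
  by (intro borel_closed closed_Collect_conj closed_Collect_le continuous_intros)

lemma emeasure_triangle_T: "emeasure lborel triangle_T = ennreal (1 / 2)"
proof -
  have "emeasure lborel triangle_T = (\<integral>\<^sup>+p. indicator triangle_T p \<partial>lborel)" by simp
  also have "\<dots> = (\<integral>\<^sup>+p. indicator open_triangle p * 1 \<partial>lborel)"
    by (rule nn_integral_cong_AE) (use AE_triangle_T in eventually_elim, simp split: split_indicator)
  also have "\<dots> = (\<integral>\<^sup>+r. indicator {0<..<1} r * ennreal (r ^ 1 * (1 - r) ^ 0) \<partial>lborel)"
    by (subst nn_integral_open_triangle) simp_all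
  also have "\<dots> = ennreal (1 / 2)" unfolding nn_integral_Beta_nat by (simp add: fact_numeral)
  finally show ?thesis .
qed

definition unif_triangle :: "(real \<times> real) measure" where
  "unif_triangle = uniform_measure lborel triangle_T"

lemma sets_unif_triangle [measurable_cong, simp]: "sets unif_triangle = sets borel"
  by (simp add: unif_triangle_def)

lemma space_unif_triangle [simp]: "space unif_triangle = UNIV"
  by (simp add: unif_triangle_def)

lemma prob_space_unif_triangle: "prob_space unif_triangle"
  unfolding unif_triangle_def by (rule prob_space_uniform_measure) (simp_all add: emeasure_triangle_T)

lemma nn_integral_unif_triangle_lborel:
  assumes [measurable]: "f \<in> borel_measurable borel"
  shows "(\<integral>\<^sup>+p. f p \<partial>unif_triangle) = 2 * (\<integral>\<^sup>+p. indicator open_triangle p * f p \<partial>lborel)"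
proof -
  have "(\<integral>\<^sup>+p. f p \<partial>unif_triangle) = (\<integral>\<^sup>+p. f p * indicator triangle_T p \<partial>lborel) / ennreal (1 / 2)"
    unfolding unif_triangle_def by (subst nn_integral_uniform_measure) (simp_all add: emeasure_triangle_T)
  also have "(\<integral>\<^sup>+p. f p * indicator triangle_T p \<partial>lborel) = (\<integral>\<^sup>+p. indicator open_triangle p * f p \<partial>lborel)"
    by (rule nn_integral_cong_AE) (use AE_triangle_T in eventually_elim, simp split: split_indicator)
  also have "x / ennreal (1 / 2) = 2 * x" for x :: ennreal
  proof -
    have "inverse (ennreal (1 / 2)) = 2" by (subst inverse_ennreal) simp_all
    then show ?thesis by (simp add: divide_ennreal_def mult.commute)
  qed
  finally show ?thesis .
qed

lemma nn_integral_unif_triangle: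
  assumes [measurable]: "f \<in> borel_measurable borel"
  shows "(\<integral>\<^sup>+p. f p \<partial>unif_triangle) =
    (\<integral>\<^sup>+r. indicator {0<..<1} r * (ennreal (2 * r) * (\<integral>\<^sup>+u. indicator {0<..<1} u * f (u * r, 1 - r) \<partial>lborel)) \<partial>lborel)"
proof -
  have *: "2 * (indicator {0<..<1} r * (ennreal r * x)) = indicator {0<..<1} r * (ennreal (2 * r) * x)" for r x
    by (simp add: ennreal_mult' mult_ac split: split_indicator)
  show ?thesis
    by (subst nn_integral_unif_triangle_lborel, simp, subst nn_integral_open_triangle, simp,
        subst nn_integral_cmult[symmetric]) (simp_all only: *, measurable)
qed

lemma measurable_chain_map [measurable]: "chain_map u r \<in> borel_measurable borel"
  unfolding chain_map_def divide_inverse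
  by (intro borel_measurable_continuous_onI continuous_intros)

lemma nn_integral_lborel_chain_map:
  assumes [measurable]: "g \<in> borel_measurable borel" and u: "u < 1" and r: "r < 1"
  shows "(\<integral>\<^sup>+q. g (chain_map u r q) \<partial>lborel) = ennreal ((1 - u) * (1 - r)) * (\<integral>\<^sup>+p. g p \<partial>lborel)"
proof -
  have ax: "(\<integral>\<^sup>+x. f ((x + b) / a) \<partial>lborel) = ennreal a * (\<integral>\<^sup>+x. f x \<partial>lborel)"
    if a: "a > 0" and [measurable]: "f \<in> borel_measurable borel" for a b :: real and f
  proof -
    have "(\<integral>\<^sup>+x. f ((x + b) / a) \<partial>lborel) = \<bar>a\<bar> * (\<integral>\<^sup>+x. f ((- b + a * x + b) / a) \<partial>lborel)"
      by (rule nn_integral_real_affine) (use a in simp_all)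
    then show ?thesis using a by simp
  qed
  have "(\<integral>\<^sup>+q. g (chain_map u r q) \<partial>lborel) = (\<integral>\<^sup>+y. \<integral>\<^sup>+x. g (chain_map u r (x, y)) \<partial>lborel \<partial>lborel)"
    by (rule nn_integral_lborel_plane) measurable
  also have "\<dots> = (\<integral>\<^sup>+y. \<integral>\<^sup>+x. g ((x + (u * y - u)) / (1 - u), (y + 0) / (1 - r)) \<partial>lborel \<partial>lborel)"
    by (simp add: chain_map_def algebra_simps)
  also have "\<dots> = (\<integral>\<^sup>+y. ennreal (1 - u) * (\<integral>\<^sup>+x. g (x, (y + 0) / (1 - r)) \<partial>lborel) \<partial>lborel)"
    by (intro nn_integral_cong ax) (use u in simp_all)
  also have "\<dots> = ennreal (1 - u) * (\<integral>\<^sup>+y. (\<integral>\<^sup>+x. g (x, (y + 0) / (1 - r)) \<partial>lborel) \<partial>lborel)"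
    by (rule nn_integral_cmult) simp
  also have "(\<integral>\<^sup>+y. (\<integral>\<^sup>+x. g (x, (y + 0) / (1 - r)) \<partial>lborel) \<partial>lborel) = ennreal (1 - r) * (\<integral>\<^sup>+y. (\<integral>\<^sup>+x. g (x, y) \<partial>lborel) \<partial>lborel)"
    by (rule ax) (use r in simp_all)
  also have "(\<integral>\<^sup>+y. (\<integral>\<^sup>+x. g (x, y) \<partial>lborel) \<partial>lborel) = (\<integral>\<^sup>+p. g p \<partial>lborel)"
    by (rule nn_integral_lborel_plane[symmetric]) simp
  finally show ?thesis using u r by (simp add: ennreal_mult' mult.assoc)
qed

text \<open>Restricted to the triangle of the remaining chain, the uniform distribution is a multiple of an
affine copy of itself; this self-similarity makes the recurrence close up.\<close>
lemma nn_integral_unif_triangle_chain_map: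
  assumes [measurable]: "f \<in> borel_measurable borel" and u: "0 < u" "u < 1" and r: "0 < r" "r < 1"
  shows "(\<integral>\<^sup>+q. indicator open_triangle (chain_map u r q) * f (chain_map u r q) \<partial>unif_triangle)
     = ennreal ((1 - u) * (1 - r)) * (\<integral>\<^sup>+p. f p \<partial>unif_triangle)"
proof -
  have "(\<integral>\<^sup>+q. indicator open_triangle (chain_map u r q) * f (chain_map u r q) \<partial>unif_triangle)
      = 2 * (\<integral>\<^sup>+q. indicator open_triangle q * (indicator open_triangle (chain_map u r q) * f (chain_map u r q)) \<partial>lborel)"
    by (rule nn_integral_unif_triangle_lborel) simp
  also have "(\<lambda>q. indicator open_triangle q * (indicator open_triangle (chain_map u r q) * f (chain_map u r q)))
      = (\<lambda>q. indicator open_triangle (chain_map u r q) * f (chain_map u r q))"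
    using chain_map_in_triangleD(2)[OF u r] by (auto simp: fun_eq_iff split: split_indicator)
  also have "(\<integral>\<^sup>+q. indicator open_triangle (chain_map u r q) * f (chain_map u r q) \<partial>lborel)
      = ennreal ((1 - u) * (1 - r)) * (\<integral>\<^sup>+p. indicator open_triangle p * f p \<partial>lborel)"
    by (rule nn_integral_lborel_chain_map) (use u r in simp_all)
  finally show ?thesis by (simp add: nn_integral_unif_triangle_lborel mult_ac)
qed

lemma sets_above [measurable]: "{q \<in> open_triangle. u * (1 - snd q) < fst q} \<in> sets borel"
  unfolding open_triangle_def mem_Collect_eq
  by (intro borel_open open_Collect_conj open_Collect_less continuous_intros)

lemma emeasure_unif_triangle_above:
  assumes u: "0 < u" "u < 1"
  shows "emeasure unif_triangle {q \<in> open_triangle. u * (1 - snd q) < fst q} = ennreal (1 - u)"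
proof -
  let ?W = "{q \<in> open_triangle. u * (1 - snd q) < fst q}"
  have "emeasure unif_triangle ?W = (\<integral>\<^sup>+q. indicator ?W q \<partial>unif_triangle)" by simp
  also have "\<dots> = (\<integral>\<^sup>+r. indicator {0<..<1} r * (ennreal (2 * r) * (\<integral>\<^sup>+v. indicator {0<..<1} v * indicator ?W (v * r, 1 - r) \<partial>lborel)) \<partial>lborel)"
    by (rule nn_integral_unif_triangle) simp
  also have "\<dots> = (\<integral>\<^sup>+r. ennreal (2 * (1 - u)) * (indicator {0<..<1} r * ennreal (r ^ 1 * (1 - r) ^ 0)) \<partial>lborel)"
  proof (rule nn_integral_cong)
    fix r :: real
    show "indicator {0<..<1} r * (ennreal (2 * r) * (\<integral>\<^sup>+v. indicator {0<..<1} v * indicator ?W (v * r, 1 - r) \<partial>lborel))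
      = ennreal (2 * (1 - u)) * (indicator {0<..<1} r * ennreal (r ^ 1 * (1 - r) ^ 0))"
    proof (cases "r \<in> {0<..<1}")
      case True
      have "indicator {0<..<1} v * indicator ?W (v * r, 1 - r) = (indicator {u<..<1} v :: ennreal)" for v
        using True u by (auto simp: open_triangle_def mult.commute[of _ r] zero_less_mult_iff split: split_indicator)
      then have "(\<integral>\<^sup>+v. indicator {0<..<1} v * indicator ?W (v * r, 1 - r) \<partial>lborel) = ennreal (1 - u)"
        using u by simp
      then show ?thesis using True u by (simp add: ennreal_mult[symmetric] mult_ac)
    qed simp
  qed
  also have "\<dots> = ennreal (2 * (1 - u)) * ennreal (fact 1 * fact 0 / fact (1 + 0 + 1))"
    unfolding nn_integral_Beta_nat[symmetric] by (rule nn_integral_cmult) simp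
  also have "\<dots> = ennreal (2 * (1 - u) * (fact 1 * fact 0 / fact (1 + 0 + 1)))"
    by (rule ennreal_mult[symmetric]) (use u in simp_all)
  also have "2 * (1 - u) * (fact 1 * fact 0 / fact (1 + 0 + 1)) = 1 - u" by (simp add: fact_numeral)
  finally show ?thesis .
qed

text \<open>Of the mass \<open>1 - u\<close> beyond the ray through \<open>V = (u r, 1 - r)\<close>, the fraction \<open>1 - r\<close> belongs to
the triangle of the remaining chain; the rest is hidden behind \<open>V\<close>.\<close>
lemma emeasure_unif_triangle_shielded:
  assumes u: "0 < u" "u < 1" and r: "0 < r" "r < 1"
  shows "emeasure unif_triangle ({q \<in> open_triangle. u * (1 - snd q) < fst q} - chain_map u r -` open_triangle) = ennreal ((1 - u) * r)"
proof -
  interpret prob_space unif_triangle by (rule prob_space_unif_triangle)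
  let ?W = "{q \<in> open_triangle. u * (1 - snd q) < fst q}" and ?D = "chain_map u r -` open_triangle"
  have D[measurable]: "?D \<in> sets borel" using measurable_sets[OF measurable_chain_map sets_open_triangle, of u r] by simp
  have "emeasure unif_triangle ?D = (\<integral>\<^sup>+q. indicator open_triangle (chain_map u r q) * 1 \<partial>unif_triangle)"
  proof -
    have "emeasure unif_triangle ?D = (\<integral>\<^sup>+q. indicator ?D q \<partial>unif_triangle)" by simp
    also have "\<dots> = (\<integral>\<^sup>+q. indicator open_triangle (chain_map u r q) * 1 \<partial>unif_triangle)"
      by (rule nn_integral_cong) (simp split: split_indicator)
    finally show ?thesis .
  qed
  also have "\<dots> = ennreal ((1 - u) * (1 - r))"
    by (subst nn_integral_unif_triangle_chain_map) (use u r emeasure_space_1 in simp_all)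
  finally have "emeasure unif_triangle (?W - ?D) = ennreal (1 - u) - ennreal ((1 - u) * (1 - r))"
    using chain_map_in_triangleD[OF u r] emeasure_unif_triangle_above[OF u]
    by (subst emeasure_Diff) (auto intro: sets_above)
  also have "\<dots> = ennreal ((1 - u) * r)"
    by (subst ennreal_minus) (use u r in simp, simp add: algebra_simps)
  finally show ?thesis .
qed

section \<open>Thinning a product measure\<close>

text \<open>A model of the configurations with a given first vertex: \<open>R\<close> is the region hidden behind it, \<open>E\<close>
the region that carries the rest of the chain and \<open>B\<close> the map that expands \<open>E\<close> to the whole
triangle; a point outside both regions contradicts the choice of the first vertex. The finite
set \<open>P\<close> of additional points is what makes an induction over the index set possible.\<close>
definition thinned :: "('a set \<Rightarrow> ennreal) \<Rightarrow> 'a set \<Rightarrow> 'a set \<Rightarrow> ('a \<Rightarrow> 'a) \<Rightarrow> 'a set \<Rightarrow> 'i set \<Rightarrow> ('i \<Rightarrow> 'a) \<Rightarrow> ennreal" where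
  "thinned \<Phi> R E B P I x = (if \<forall>i\<in>I. x i \<in> R \<union> E then \<Phi> (P \<union> B ` {q \<in> x ` I. q \<in> E}) else 0)"

text \<open>The samples are sorted by the set \<open>S\<close> of the indices whose points lie in \<open>E\<close>, so that at most
one summand is nonzero. This form makes measurability evident.\<close>
lemma thinned_eq_sum:
  assumes "finite I" and disj: "R \<inter> E = {}"
  shows "thinned \<Phi> R E B P I x =
    (\<Sum>S\<in>Pow I. (\<Prod>i\<in>S. indicator E (x i)) * (\<Prod>i\<in>I - S. indicator R (x i)) * \<Phi> (P \<union> (\<lambda>i. B (x i)) ` S))"
proof -
  define T where "T = {i \<in> I. x i \<in> E}"
  let ?t = "\<lambda>S. (\<Prod>i\<in>S. indicator E (x i)) * (\<Prod>i\<in>I - S. indicator R (x i)) * \<Phi> (P \<union> (\<lambda>i. B (x i)) ` S)"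
  have t0: "?t S = 0" if S: "S \<in> Pow I" "S \<noteq> T" for S
  proof -
    have "finite S" using S assms(1) finite_subset by blast
    consider i where "i \<in> S" "x i \<notin> E" | i where "i \<in> I - S" "x i \<notin> R"
      using S disj by (auto simp: T_def)
    then have "(\<Prod>i\<in>S. indicator E (x i)) = (0::ennreal) \<or> (\<Prod>i\<in>I - S. indicator R (x i)) = (0::ennreal)"
    proof cases
      case (1 i)
      then have "(\<Prod>i\<in>S. indicator E (x i)) = (0::ennreal)"
        using \<open>finite S\<close> by (intro prod_zero bexI[of _ i]) auto
      then show ?thesis ..
    next
      case (2 i)
      then have "(\<Prod>i\<in>I - S. indicator R (x i)) = (0::ennreal)"
        using assms(1) by (intro prod_zero bexI[of _ i]) auto
      then show ?thesis ..
    qed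
    then show ?thesis by auto
  qed
  have "(\<Sum>S\<in>Pow I. ?t S) = (\<Sum>S\<in>{T}. ?t S)"
    by (rule sum.mono_neutral_right) (use t0 assms(1) in \<open>auto simp: T_def\<close>)
  also have "\<dots> = ?t T" by simp
  also have "\<dots> = thinned \<Phi> R E B P I x"
  proof -
    have E: "(\<Prod>i\<in>T. indicator E (x i)) = (1::ennreal)" by (rule prod.neutral) (auto simp: T_def)
    have im: "B ` {q \<in> x ` I. q \<in> E} = (\<lambda>i. B (x i)) ` T" by (auto simp: T_def)
    show ?thesis
    proof (cases "\<forall>i\<in>I. x i \<in> R \<union> E")
      case True
      then have "(\<Prod>i\<in>I - T. indicator R (x i)) = (1::ennreal)" by (intro prod.neutral) (auto simp: T_def)
      then show ?thesis using E im True by (simp add: thinned_def)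
    next
      case False
      then obtain i where "i \<in> I - T" "x i \<notin> R" by (auto simp: T_def)
      then have "(\<Prod>i\<in>I - T. indicator R (x i)) = (0::ennreal)" using assms(1) by (intro prod_zero bexI[of _ i]) auto
      then show ?thesis using False by (auto simp: thinned_def)
    qed
  qed
  finally show ?thesis by simp
qed

lemma measurable_thinned:
  fixes D :: "'a measure" and I :: "'i set" and \<Phi> :: "'a set \<Rightarrow> ennreal"
  assumes fin: "finite I" "finite P"
    and [measurable]: "R \<in> sets D" "E \<in> sets D" "B \<in> measurable D D"
    and disj: "R \<inter> E = {}"
    and \<Phi>: "\<And>S P N (y :: 'i \<Rightarrow> ('i \<Rightarrow> 'a) \<Rightarrow> 'a). finite S \<Longrightarrow> finite P \<Longrightarrow>
      (\<And>i. i \<in> S \<Longrightarrow> y i \<in> measurable N D) \<Longrightarrow> (\<lambda>x. \<Phi> (P \<union> (\<lambda>i. y i x) ` S)) \<in> borel_measurable N"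
  shows "thinned \<Phi> R E B P I \<in> borel_measurable (PiM I (\<lambda>_. D))"
proof -
  have fS: "finite S" if "S \<in> Pow I" for S using that fin finite_subset by blast
  have [measurable]: "(\<lambda>x. \<Phi> (P \<union> (\<lambda>i. B (x i)) ` S)) \<in> borel_measurable (PiM I (\<lambda>_. D))" if "S \<in> Pow I" for S
    by (rule \<Phi>) (use that fS fin in \<open>auto intro!: measurable_compose[OF measurable_component_singleton]\<close>)
  have [measurable]: "(\<lambda>x. indicator A (x i) :: ennreal) \<in> borel_measurable (PiM I (\<lambda>_. D))" if "A \<in> sets D" "i \<in> I" for A i
    using that by (intro measurable_compose[OF measurable_component_singleton]) auto
  have "(\<lambda>x. \<Sum>S\<in>Pow I. (\<Prod>i\<in>S. indicator E (x i)) * (\<Prod>i\<in>I - S. indicator R (x i)) * \<Phi> (P \<union> (\<lambda>i. B (x i)) ` S))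
    \<in> borel_measurable (PiM I (\<lambda>_. D))"
    by (intro borel_measurable_sum borel_measurable_times_ennreal borel_measurable_prod_ennreal) (auto)
  then show ?thesis using thinned_eq_sum[OF fin(1) disj] by (simp add: fun_eq_iff cong: measurable_cong)
qed

text \<open>The points in \<open>E\<close> form a subsample indexed by some \<open>S\<close> that is distributed, after applying \<open>B\<close>,
like a full sample up to the factor \<open>c\<close> per point, while each other point contributes the mass
of \<open>R\<close>. In the induction step, the new point is either dropped or, after the transformation,
joins \<open>P\<close>; Fubini returns it to the sample.\<close>
lemma nn_integral_thinned:
  fixes D :: "'a measure" and I :: "'i set" and \<Phi> :: "'a set \<Rightarrow> ennreal"
  assumes D: "sigma_finite_measure D" and fin: "finite I" "finite P"
    and [measurable]: "R \<in> sets D" "E \<in> sets D" "B \<in> measurable D D"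
    and disj: "R \<inter> E = {}"
    and scale: "\<And>f. f \<in> borel_measurable D \<Longrightarrow> (\<integral>\<^sup>+q. indicator E q * f (B q) \<partial>D) = c * (\<integral>\<^sup>+q. f q \<partial>D)"
    and \<Phi>: "\<And>S P N (y :: 'i \<Rightarrow> ('i \<Rightarrow> 'a) \<Rightarrow> 'a). finite S \<Longrightarrow> finite P \<Longrightarrow>
      (\<And>i. i \<in> S \<Longrightarrow> y i \<in> measurable N D) \<Longrightarrow> (\<lambda>x. \<Phi> (P \<union> (\<lambda>i. y i x) ` S)) \<in> borel_measurable N"
  shows "(\<integral>\<^sup>+x. thinned \<Phi> R E B P I x \<partial>PiM I (\<lambda>_. D)) =
    (\<Sum>S\<in>Pow I. emeasure D R ^ (card I - card S) * c ^ card S * (\<integral>\<^sup>+x. \<Phi> (P \<union> x ` S) \<partial>PiM S (\<lambda>_. D)))"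
  using fin
proof (induction I arbitrary: P rule: finite_induct)
  case (empty P)
  then show ?case by (simp add: thinned_def)
next
  case (insert i I P)
  interpret product_sigma_finite "\<lambda>_. D" by (rule product_sigma_finite.intro) (rule D)
  let ?\<rho> = "emeasure D R"
  let ?w = "\<lambda>S. ?\<rho> ^ (card I - card S) * c ^ card S"
  let ?J = "\<lambda>S P. \<integral>\<^sup>+x. \<Phi> (P \<union> x ` S) \<partial>PiM S (\<lambda>_. D)"
  have fI: "finite I" and iI: "i \<notin> I" and fP: "finite P" using insert by auto
  have meas: "thinned \<Phi> R E B P I \<in> borel_measurable (PiM I (\<lambda>_. D))" if "finite I" "finite P" for I :: "'i set" and P
  proof (rule measurable_thinned[OF that])
    show "R \<inter> E = {}" by (rule disj)
    show "(\<lambda>x. \<Phi> (P \<union> (\<lambda>i. y i x) ` S)) \<in> borel_measurable N"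
      if "finite S" "finite P" "\<And>i. i \<in> S \<Longrightarrow> y i \<in> measurable N D"
      for S P N and y :: "'i \<Rightarrow> ('i \<Rightarrow> 'a) \<Rightarrow> 'a"
      using that by (rule \<Phi>)
  qed simp_all
  have split: "thinned \<Phi> R E B P (insert i I) (x(i := y))
      = indicator R y * thinned \<Phi> R E B P I x + indicator E y * thinned \<Phi> R E B (insert (B y) P) I x" for x y
  proof -
    have im: "(x(i := y)) ` insert i I = insert y (x ` I)" using iI by auto
    have all: "(\<forall>j\<in>insert i I. (x(i := y)) j \<in> R \<union> E) \<longleftrightarrow> y \<in> R \<union> E \<and> (\<forall>j\<in>I. x j \<in> R \<union> E)" using iI by auto
    have eq: "thinned \<Phi> R E B P (insert i I) (x(i := y)) =
        (if y \<in> R \<union> E \<and> (\<forall>j\<in>I. x j \<in> R \<union> E) then \<Phi> (P \<union> B ` {q \<in> insert y (x ` I). q \<in> E}) else 0)"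
      unfolding thinned_def im all ..
    consider "y \<in> R" "y \<notin> E" | "y \<in> E" "y \<notin> R" | "y \<notin> E" "y \<notin> R" using disj by blast
    then show ?thesis
    proof cases
      case 1
      then have "{q \<in> insert y (x ` I). q \<in> E} = {q \<in> x ` I. q \<in> E}" by auto
      then show ?thesis using 1 unfolding eq by (auto simp: thinned_def)
    next
      case 2
      then have "{q \<in> insert y (x ` I). q \<in> E} = insert y {q \<in> x ` I. q \<in> E}" by auto
      then show ?thesis using 2 unfolding eq by (auto simp: thinned_def)
    next
      case 3
      then show ?thesis unfolding eq by simp
    qed
  qed
  have Jmeas: "(\<lambda>w. ?J S (insert w P)) \<in> borel_measurable D" and Jint: "(\<integral>\<^sup>+w. ?J S (insert w P) \<partial>D) = ?J (insert i S) P"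
    if "S \<in> Pow I" for S
  proof -
    have S: "finite S" "i \<notin> S" using that fI iI finite_subset by auto
    have [measurable]: "(\<lambda>x. \<Phi> (P \<union> x ` insert i S)) \<in> borel_measurable (PiM (insert i S) (\<lambda>_. D))"
      by (rule \<Phi>) (use S fP in auto)
    have eq: "P \<union> (x(i := w)) ` insert i S = insert w P \<union> x ` S" for x w using S by auto
    have *: "(\<lambda>w. \<integral>\<^sup>+x. \<Phi> (P \<union> (x(i := w)) ` insert i S) \<partial>PiM S (\<lambda>_. D)) \<in> borel_measurable D"
    proof -
      interpret S: finite_product_sigma_finite "\<lambda>_. D" S by standard (rule S)
      show ?thesis by measurable
    qed
    then show "(\<lambda>w. ?J S (insert w P)) \<in> borel_measurable D" unfolding eq .
    show "(\<integral>\<^sup>+w. ?J S (insert w P) \<partial>D) = ?J (insert i S) P"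
      by (subst product_nn_integral_insert_rev[OF S]) (simp_all only: eq, measurable)
  qed
  have "(\<integral>\<^sup>+x. thinned \<Phi> R E B P (insert i I) x \<partial>PiM (insert i I) (\<lambda>_. D))
     = (\<integral>\<^sup>+y. \<integral>\<^sup>+x. thinned \<Phi> R E B P (insert i I) (x(i := y)) \<partial>PiM I (\<lambda>_. D) \<partial>D)"
    by (rule product_nn_integral_insert_rev) (use fI iI fP meas in auto)
  also have "\<dots> = (\<integral>\<^sup>+y. indicator R y * (\<Sum>S\<in>Pow I. ?w S * ?J S P) + indicator E y * (\<Sum>S\<in>Pow I. ?w S * ?J S (insert (B y) P)) \<partial>D)"
    unfolding split using meas[OF fI] fP
    by (subst nn_integral_add) (simp_all add: nn_integral_cmult insert.IH)
  also have "\<dots> = ?\<rho> * (\<Sum>S\<in>Pow I. ?w S * ?J S P) + c * (\<integral>\<^sup>+w. (\<Sum>S\<in>Pow I. ?w S * ?J S (insert w P)) \<partial>D)"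
  proof -
    define K where "K w = (\<Sum>S\<in>Pow I. ?w S * ?J S (insert w P))" for w
    define A where "A = (\<Sum>S\<in>Pow I. ?w S * ?J S P)"
    have [measurable]: "K \<in> borel_measurable D"
      unfolding K_def by (intro borel_measurable_sum borel_measurable_times_ennreal Jmeas) auto
    have "(\<integral>\<^sup>+y. indicator R y * A + indicator E y * K (B y) \<partial>D) = ?\<rho> * A + c * (\<integral>\<^sup>+w. K w \<partial>D)"
      by (subst nn_integral_add) (simp_all add: nn_integral_multc scale)
    then show ?thesis unfolding K_def A_def .
  qed
  also have "(\<integral>\<^sup>+w. (\<Sum>S\<in>Pow I. ?w S * ?J S (insert w P)) \<partial>D) = (\<Sum>S\<in>Pow I. ?w S * ?J (insert i S) P)"
  proof -
    have "(\<integral>\<^sup>+w. (\<Sum>S\<in>Pow I. ?w S * ?J S (insert w P)) \<partial>D) = (\<Sum>S\<in>Pow I. \<integral>\<^sup>+w. ?w S * ?J S (insert w P) \<partial>D)"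
      by (rule nn_integral_sum) (intro borel_measurable_times_ennreal Jmeas borel_measurable_const)
    also have "\<dots> = (\<Sum>S\<in>Pow I. ?w S * ?J (insert i S) P)"
      by (rule sum.cong) (simp_all only: nn_integral_cmult[OF Jmeas] Jint)
    finally show ?thesis .
  qed
  also have "?\<rho> * (\<Sum>S\<in>Pow I. ?w S * ?J S P) + c * (\<Sum>S\<in>Pow I. ?w S * ?J (insert i S) P)
     = (\<Sum>S\<in>Pow I. ?\<rho> ^ (card (insert i I) - card S) * c ^ card S * ?J S P)
       + (\<Sum>S\<in>insert i ` Pow I. ?\<rho> ^ (card (insert i I) - card S) * c ^ card S * ?J S P)"
  proof -
    have fS: "finite S" if "S \<in> Pow I" for S using that fI finite_subset by blast
    have inj: "inj_on (insert i) (Pow I)" using iI by (auto simp: inj_on_def)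
    have 1: "?\<rho> * (?w S * ?J S P) = ?\<rho> ^ (card (insert i I) - card S) * c ^ card S * ?J S P" if "S \<in> Pow I" for S
    proof -
      have "card (insert i I) - card S = Suc (card I - card S)"
        using that fI iI card_mono[OF fI] by (auto simp: Suc_diff_le)
      then show ?thesis by (simp add: mult.assoc)
    qed
    have 2: "c * (?w S * ?J (insert i S) P) = ?\<rho> ^ (card (insert i I) - card (insert i S)) * c ^ card (insert i S) * ?J (insert i S) P" if "S \<in> Pow I" for S
    proof -
      have "card (insert i S) = Suc (card S)" using that fS iI by (subst card_insert_disjoint) auto
      then show ?thesis using fI iI by (simp add: mult_ac)
    qed
    show ?thesis unfolding sum.reindex[OF inj] sum_distrib_left
      by (intro arg_cong2[where f = "(+)"] sum.cong refl) (simp_all only: o_def 1 2)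
  qed
  also have "\<dots> = (\<Sum>S\<in>Pow (insert i I). ?\<rho> ^ (card (insert i I) - card S) * c ^ card S * ?J S P)"
    unfolding Pow_insert by (rule sum.union_disjoint[symmetric]) (use fI iI in auto)
  finally show ?case .
qed

lemma sum_Pow_card:
  fixes h :: "nat \<Rightarrow> 'b::comm_semiring_1"
  assumes "finite I"
  shows "(\<Sum>S\<in>Pow I. h (card S)) = (\<Sum>j\<le>card I. of_nat (card I choose j) * h j)"
proof -
  have "(\<Sum>S\<in>Pow I. h (card S)) = (\<Sum>j\<le>card I. \<Sum>S\<in>{S \<in> Pow I. card S = j}. h (card S))"
    by (rule sum.group[symmetric]) (use assms in \<open>auto intro: card_mono\<close>)
  also have "\<dots> = (\<Sum>j\<le>card I. of_nat (card I choose j) * h j)"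
    using n_subsets[OF assms] by (intro sum.cong) (auto simp: Pow_def)
  finally show ?thesis .
qed

section \<open>The generating function of the number of vertices\<close>

text \<open>The recurrence obtained by splitting off the vertex next to \<open>(0, 1)\<close>; the start value \<open>z\<^sup>2\<close>
accounts for the two endpoints.\<close>
fun chain_gf :: "real \<Rightarrow> nat \<Rightarrow> real" where
  "chain_gf z 0 = z\<^sup>2"
| "chain_gf z (Suc n) = 2 * z / (real (Suc n) * real (n + 2)) * (\<Sum>j\<le>n. real (Suc n - j) * chain_gf z j)"

declare chain_gf.simps(2) [simp del]

lemma chain_gf_pos: "z > 0 \<Longrightarrow> chain_gf z n > 0"
proof (induction n rule: less_induct)
  case (less n)
  show ?case
  proof (cases n)
    case (Suc m)
    have "(\<Sum>j\<le>m. real (Suc m - j) * chain_gf z j) > 0"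
      by (rule sum_pos) (use less Suc in auto)
    then show ?thesis using less.prems Suc by (simp add: chain_gf.simps(2) del: of_nat_Suc of_nat_add)
  qed (use less in auto)
qed

text \<open>The recurrence conserves mass. This is what later yields that almost surely some sample point is
the vertex next to \<open>(0, 1)\<close>, see \<open>first_vertex_AE\<close>.\<close>
lemma chain_gf_one [simp]: "chain_gf 1 n = 1"
proof (induction n rule: less_induct)
  case (less n)
  show ?case
  proof (cases n)
    case (Suc m)
    have "(\<Sum>j\<le>m. real (Suc m - j) * chain_gf 1 j) = (\<Sum>j\<le>m. real (Suc m - j))"
      by (rule sum.cong) (use less Suc in auto)
    also have "\<dots> = real (Suc m) * real (m + 2) / 2"
    proof (induction m)
      case (Suc m)
      have "(\<Sum>j\<le>Suc m. real (Suc (Suc m) - j)) = (\<Sum>j\<le>m. real (Suc m - j) + 1) + 1"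
        by (simp add: Suc_diff_le)
      also have "\<dots> = (\<Sum>j\<le>m. real (Suc m - j)) + real m + 2" by (simp only: sum.distrib) simp
      finally show ?case unfolding Suc.IH by (simp add: field_simps)
    qed auto
    finally have "chain_gf 1 (Suc m) = 2 * 1 / (real (Suc m) * real (m + 2)) * (real (Suc m) * real (m + 2) / 2)"
      by (simp only: chain_gf.simps(2))
    also have "\<dots> = 1" by (simp del: of_nat_Suc of_nat_add)
    finally show ?thesis using Suc by simp
  qed auto
qed

abbreviation iid_triangle :: "nat set \<Rightarrow> (nat \<Rightarrow> real \<times> real) measure" where
  "iid_triangle I \<equiv> PiM I (\<lambda>_. unif_triangle)"

lemma prob_space_iid_triangle: "prob_space (iid_triangle I)"
  by (rule prob_space_PiM) (rule prob_space_unif_triangle)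

definition vertex_weight :: "real \<Rightarrow> (real \<times> real) set \<Rightarrow> ennreal" where
  "vertex_weight z F = ennreal (z ^ nverts F)"

lemma measurable_vertex_weight:
  assumes "finite S" "finite P" "\<And>i. i \<in> S \<Longrightarrow> y i \<in> borel_measurable N"
  shows "(\<lambda>x. vertex_weight z (P \<union> (\<lambda>i. y i x) ` S)) \<in> borel_measurable N"
proof -
  note [measurable] = measurable_nverts[OF assms]
  show ?thesis unfolding vertex_weight_def by measurable
qed

text \<open>The ray from \<open>(0, 1)\<close> through a point \<open>p\<close> meets the horizontal axis in the abscissa
\<open>fst p / (1 - snd p)\<close>. The point with the strictly smallest abscissa is the vertex next to
\<open>(0, 1)\<close>; the comparison is stated without division.\<close>
definition first_vertex :: "nat set \<Rightarrow> nat \<Rightarrow> (nat \<Rightarrow> real \<times> real) \<Rightarrow> bool" where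
  "first_vertex I i x \<longleftrightarrow> x i \<in> open_triangle \<and>
    (\<forall>j\<in>I - {i}. x j \<in> open_triangle \<and> fst (x i) * (1 - snd (x j)) < fst (x j) * (1 - snd (x i)))"

lemma pred_first_vertex [measurable]:
  assumes "finite I" "i \<in> I"
  shows "Measurable.pred (iid_triangle I) (first_vertex I i)"
proof -
  have b: "(\<lambda>x. x j) \<in> borel_measurable (iid_triangle I)" if "j \<in> I" for j
    using measurable_component_singleton[OF that, of "\<lambda>_. unif_triangle"] by (simp cong: measurable_cong_sets)
  have [measurable]: "(\<lambda>x. fst (x j)) \<in> borel_measurable (iid_triangle I)" "(\<lambda>x. snd (x j)) \<in> borel_measurable (iid_triangle I)"
    if "j \<in> I" for j
    using b[OF that] by (auto intro!: measurable_compose[OF b[OF that]] borel_measurable_continuous_onI continuous_intros)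
  have [measurable]: "Measurable.pred (iid_triangle I) (\<lambda>x. x j \<in> open_triangle)" if "j \<in> I" for j
    by (rule pred_sets2[OF sets_open_triangle b[OF that]])
  show ?thesis unfolding first_vertex_def using assms by measurable
qed

lemma first_vertex_unique:
  assumes "first_vertex I i x" "first_vertex I j x" "i \<in> I" "j \<in> I"
  shows "i = j"
proof (rule ccontr)
  assume "i \<noteq> j"
  then have "fst (x i) * (1 - snd (x j)) < fst (x j) * (1 - snd (x i))" "fst (x j) * (1 - snd (x i)) < fst (x i) * (1 - snd (x j))"
    using assms by (auto simp: first_vertex_def)
  then show False by simp
qed

lemma vertex_weight_first_vertex:
  assumes u: "0 < u" "u < 1" and r: "0 < r" "r < 1" and z: "z > 0" and I: "finite I" "i \<in> I"
  defines "W \<equiv> {q \<in> open_triangle. u * (1 - snd q) < fst q}" and "E \<equiv> chain_map u r -` open_triangle"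
  shows "indicator {x. first_vertex I i x} (x(i := (u * r, 1 - r))) * vertex_weight z ((x(i := (u * r, 1 - r))) ` I)
    = ennreal z * thinned (vertex_weight z) (W - E) E (chain_map u r) {} (I - {i}) x"
proof -
  let ?V = "(u * r, 1 - r)"
  have "u * r < 1 * r" by (rule mult_strict_right_mono) (use u r in auto)
  then have V: "?V \<in> open_triangle" using u r by (auto simp: open_triangle_def)
  have EW: "E \<subseteq> W" using chain_map_in_triangleD[OF u r] by (auto simp: E_def W_def)
  have "u * r * (1 - snd q) < fst q * (1 - (1 - r)) \<longleftrightarrow> u * (1 - snd q) < fst q" for q
  proof -
    have "u * r * (1 - snd q) < fst q * (1 - (1 - r)) \<longleftrightarrow> u * (1 - snd q) * r < fst q * r" by (simp add: mult_ac)
    then show ?thesis using r by simp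
  qed
  then have first: "first_vertex I i (x(i := ?V)) \<longleftrightarrow> (\<forall>j\<in>I - {i}. x j \<in> W)"
    using V by (auto simp: first_vertex_def W_def)
  have WE: "W - E \<union> E = W" using EW by auto
  have im: "(x(i := ?V)) ` I = insert ?V (x ` (I - {i}))" using I by auto
  show ?thesis
  proof (cases "\<forall>j\<in>I - {i}. x j \<in> W")
    case True
    have "nverts (insert ?V (x ` (I - {i}))) = Suc (nverts (chain_map u r ` {q \<in> x ` (I - {i}). chain_map u r q \<in> open_triangle}))"
      by (rule nverts_first_vertex[OF u r]) (use True I in \<open>auto simp: W_def\<close>)
    also have "{q \<in> x ` (I - {i}). chain_map u r q \<in> open_triangle} = {q \<in> x ` (I - {i}). q \<in> E}" by (auto simp: E_def)
    finally have "vertex_weight z ((x(i := ?V)) ` I) = ennreal z * vertex_weight z (chain_map u r ` {q \<in> x ` (I - {i}). q \<in> E})"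
      unfolding im vertex_weight_def using z by (simp add: ennreal_mult)
    moreover have "thinned (vertex_weight z) (W - E) E (chain_map u r) {} (I - {i}) x = vertex_weight z (chain_map u r ` {q \<in> x ` (I - {i}). q \<in> E})"
      unfolding thinned_def WE using True by simp
    ultimately show ?thesis using first True by simp
  next
    case False
    then have "thinned (vertex_weight z) (W - E) E (chain_map u r) {} (I - {i}) x = 0"
      by (simp only: thinned_def WE if_False)
    then show ?thesis using first False by simp
  qed
qed

text \<open>The integral over the position \<open>(u r, 1 - r)\<close> of the first vertex. The powers of \<open>1 - u\<close> combine
to \<open>(1 - u) ^ m\<close> whatever \<open>j\<close> is, so the integral over \<open>u\<close> separates, and the Beta integral over
\<open>r\<close> cancels the binomial coefficient up to the linear weight.\<close>
lemma chain_integral: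
  assumes g: "\<And>j. g j \<ge> 0" and z: "z > 0"
  shows "(\<integral>\<^sup>+r. indicator {0<..<1} r * (ennreal (2 * r) * (\<integral>\<^sup>+u. indicator {0<..<1} u *
      (ennreal z * (\<Sum>j\<le>m. of_nat (m choose j) * (ennreal ((1 - u) * r) ^ (m - j) * ennreal ((1 - u) * (1 - r)) ^ j * ennreal (g j)))) \<partial>lborel)) \<partial>lborel)
    = ennreal (2 * z / (real (m + 1) * (real (m + 1) * real (m + 2))) * (\<Sum>j\<le>m. real (Suc m - j) * g j))"
proof -
  define Q where "Q r = (\<Sum>j\<le>m. 2 * z * (real (m choose j) * g j) / real (m + 1) * (r ^ (m - j + 1) * (1 - r) ^ j))" for r :: real
  have inner: "ennreal (2 * r) * (\<integral>\<^sup>+u. indicator {0<..<1} u *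
      (ennreal z * (\<Sum>j\<le>m. of_nat (m choose j) * (ennreal ((1 - u) * r) ^ (m - j) * ennreal ((1 - u) * (1 - r)) ^ j * ennreal (g j)))) \<partial>lborel)
      = ennreal (Q r)" if r: "0 < r" "r < 1" for r
  proof -
    define q where "q = (\<Sum>j\<le>m. real (m choose j) * (r ^ (m - j) * (1 - r) ^ j * g j))"
    have q: "q \<ge> 0" unfolding q_def by (intro sum_nonneg mult_nonneg_nonneg) (use r g in auto)
    have 1: "indicator {0<..<1} u * (ennreal z * (\<Sum>j\<le>m. of_nat (m choose j) * (ennreal ((1 - u) * r) ^ (m - j) * ennreal ((1 - u) * (1 - r)) ^ j * ennreal (g j))))
        = ennreal (z * q) * (indicator {0<..<1} u * ennreal (u ^ 0 * (1 - u) ^ m))" for u :: real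
    proof (cases "u \<in> {0<..<1}")
      case True
      have "of_nat (m choose j) * (ennreal ((1 - u) * r) ^ (m - j) * ennreal ((1 - u) * (1 - r)) ^ j * ennreal (g j))
         = ennreal (real (m choose j) * (r ^ (m - j) * (1 - r) ^ j * g j) * (1 - u) ^ m)" if "j \<le> m" for j
      proof -
        have "(1 - u) ^ m = (1 - u) ^ (m - j) * (1 - u) ^ j" using that by (simp add: power_add[symmetric])
        then have e: "real (m choose j) * (r ^ (m - j) * (1 - r) ^ j * g j) * (1 - u) ^ m
            = real (m choose j) * (((1 - u) * r) ^ (m - j) * ((1 - u) * (1 - r)) ^ j * g j)"
          by (simp add: power_mult_distrib mult_ac)
        have "0 \<le> (1 - u) * r" "0 \<le> (1 - u) * (1 - r)" using True r by auto
        then show ?thesis unfolding e using g[of j]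
          by (simp add: ennreal_power ennreal_mult[symmetric] ennreal_of_nat_eq_real_of_nat)
      qed
      then have "(\<Sum>j\<le>m. of_nat (m choose j) * (ennreal ((1 - u) * r) ^ (m - j) * ennreal ((1 - u) * (1 - r)) ^ j * ennreal (g j)))
         = (\<Sum>j\<le>m. ennreal (real (m choose j) * (r ^ (m - j) * (1 - r) ^ j * g j) * (1 - u) ^ m))"
        by (intro sum.cong) auto
      also have "\<dots> = ennreal (\<Sum>j\<le>m. real (m choose j) * (r ^ (m - j) * (1 - r) ^ j * g j) * (1 - u) ^ m)"
        by (rule sum_ennreal) (use True r g in auto)
      also have "(\<Sum>j\<le>m. real (m choose j) * (r ^ (m - j) * (1 - r) ^ j * g j) * (1 - u) ^ m) = q * (1 - u) ^ m"
        by (simp add: q_def sum_distrib_right)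
      finally show ?thesis using True z q by (simp add: ennreal_mult[symmetric] mult.assoc)
    qed simp
    have "(\<integral>\<^sup>+u. ennreal (z * q) * (indicator {0<..<1} u * ennreal (u ^ 0 * (1 - u) ^ m)) \<partial>lborel)
        = ennreal (z * q) * ennreal (fact 0 * fact m / fact (0 + m + 1))"
      unfolding nn_integral_Beta_nat[symmetric] by (rule nn_integral_cmult) simp
    also have "\<dots> = ennreal (z * q / real (m + 1))"
      using z q by (simp add: ennreal_mult[symmetric])
    also have "ennreal (2 * r) * \<dots> = ennreal (Q r)"
    proof -
      have "2 * r * (z * q / real (m + 1)) = Q r"
        unfolding Q_def q_def by (simp add: sum_distrib_left sum_distrib_right sum_divide_distrib mult_ac)
      then show ?thesis using r z q by (simp add: ennreal_mult[symmetric])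
    qed
    finally show ?thesis unfolding 1 .
  qed
  have "(\<integral>\<^sup>+r. indicator {0<..<1} r * (ennreal (2 * r) * (\<integral>\<^sup>+u. indicator {0<..<1} u *
      (ennreal z * (\<Sum>j\<le>m. of_nat (m choose j) * (ennreal ((1 - u) * r) ^ (m - j) * ennreal ((1 - u) * (1 - r)) ^ j * ennreal (g j)))) \<partial>lborel)) \<partial>lborel)
    = (\<integral>\<^sup>+r. (\<Sum>j\<le>m. ennreal (2 * z * (real (m choose j) * g j) / real (m + 1)) * (indicator {0<..<1} r * ennreal (r ^ (m - j + 1) * (1 - r) ^ j))) \<partial>lborel)"
  proof (rule nn_integral_cong)
    fix r :: real
    show "indicator {0<..<1} r * (ennreal (2 * r) * (\<integral>\<^sup>+u. indicator {0<..<1} u *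
      (ennreal z * (\<Sum>j\<le>m. of_nat (m choose j) * (ennreal ((1 - u) * r) ^ (m - j) * ennreal ((1 - u) * (1 - r)) ^ j * ennreal (g j)))) \<partial>lborel))
      = (\<Sum>j\<le>m. ennreal (2 * z * (real (m choose j) * g j) / real (m + 1)) * (indicator {0<..<1} r * ennreal (r ^ (m - j + 1) * (1 - r) ^ j)))"
    proof (cases "r \<in> {0<..<1}")
      case True
      have "ennreal (Q r) = (\<Sum>j\<le>m. ennreal (2 * z * (real (m choose j) * g j) / real (m + 1) * (r ^ (m - j + 1) * (1 - r) ^ j)))"
        unfolding Q_def by (rule sum_ennreal[symmetric]) (use True z g in auto)
      also have "\<dots> = (\<Sum>j\<le>m. ennreal (2 * z * (real (m choose j) * g j) / real (m + 1)) * ennreal (r ^ (m - j + 1) * (1 - r) ^ j))"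
        by (intro sum.cong ennreal_mult) (use True z g in auto)
      finally show ?thesis using inner[of r] True by simp
    qed simp
  qed
  also have "\<dots> = (\<Sum>j\<le>m. ennreal (2 * z * (real (m choose j) * g j) / real (m + 1)) * ennreal (fact (m - j + 1) * fact j / fact (m - j + 1 + j + 1)))"
    unfolding nn_integral_Beta_nat[symmetric] by (subst nn_integral_sum) (simp_all add: nn_integral_cmult)
  also have "\<dots> = (\<Sum>j\<le>m. ennreal (2 * z / (real (m + 1) * (real (m + 1) * real (m + 2))) * (real (Suc m - j) * g j)))"
  proof (rule sum.cong)
    fix j assume "j \<in> {..m}"
    then have j: "j \<le> m" by simp
    have 1: "real (m choose j) * (fact j * fact (m - j)) = fact m"
      using binomial_fact_lemma[OF j] by (metis (mono_tags) mult.commute of_nat_fact of_nat_mult)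
    have 2: "fact (m - j + 1) = real (Suc m - j) * fact (m - j)" using j by (simp add: Suc_diff_le)
    have "real (m choose j) * (fact (m - j + 1) * fact j) = real (Suc m - j) * (real (m choose j) * (fact j * fact (m - j)))"
      unfolding 2 by (simp only: mult_ac)
    also have "\<dots> = real (Suc m - j) * fact m" unfolding 1 ..
    finally have "real (m choose j) * (fact (m - j + 1) * fact j) = real (Suc m - j) * fact m" .
    moreover have "fact (m - j + 1 + j + 1) = real (m + 1) * real (m + 2) * fact m" using j by (simp add: mult_ac)
    ultimately have "real (m choose j) * (fact (m - j + 1) * fact j / fact (m - j + 1 + j + 1)) = real (Suc m - j) / (real (m + 1) * real (m + 2))"
      by (simp only: times_divide_eq_right) simp
    then have "2 * z * (real (m choose j) * g j) / real (m + 1) * (fact (m - j + 1) * fact j / fact (m - j + 1 + j + 1))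
        = 2 * z * g j / real (m + 1) * (real (Suc m - j) / (real (m + 1) * real (m + 2)))"
    proof -
      have "2 * z * (c * b) / M * F = 2 * z * b / M * (c * F)" for c b M F :: real by simp
      from this[of "real (m choose j)" "g j" "real (m + 1)"] show ?thesis
        using \<open>real (m choose j) * (fact (m - j + 1) * fact j / fact (m - j + 1 + j + 1)) = _\<close> by (simp only:)
    qed
    also have "\<dots> = 2 * z / (real (m + 1) * (real (m + 1) * real (m + 2))) * (real (Suc m - j) * g j)" by simp
    finally show "ennreal (2 * z * (real (m choose j) * g j) / real (m + 1)) * ennreal (fact (m - j + 1) * fact j / fact (m - j + 1 + j + 1))
        = ennreal (2 * z / (real (m + 1) * (real (m + 1) * real (m + 2))) * (real (Suc m - j) * g j))"
      using z g[of j] by (subst ennreal_mult[symmetric]) simp_all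
  qed simp
  also have "\<dots> = ennreal (\<Sum>j\<le>m. 2 * z / (real (m + 1) * (real (m + 1) * real (m + 2))) * (real (Suc m - j) * g j))"
    by (rule sum_ennreal) (use z g in auto)
  finally show ?thesis by (simp add: sum_distrib_left)
qed

text \<open>Conditioning on the point \<open>i\<close>: if it is the first vertex, the others form a thinned sample to
which the knowledge about smaller samples applies.\<close>
lemma nn_integral_first_vertex:
  assumes I: "finite I" "i \<in> I" "card I = Suc m" and z: "z > 0"
    and g: "\<And>j. g j \<ge> 0" "\<And>S. S \<subseteq> I - {i} \<Longrightarrow> (\<integral>\<^sup>+x. vertex_weight z (x ` S) \<partial>iid_triangle S) = ennreal (g (card S))"
  shows "(\<integral>\<^sup>+x. indicator {x. first_vertex I i x} x * vertex_weight z (x ` I) \<partial>iid_triangle I)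
    = ennreal (2 * z / (real (m + 1) * (real (m + 1) * real (m + 2))) * (\<Sum>j\<le>m. real (Suc m - j) * g j))"
proof -
  interpret product_sigma_finite "\<lambda>_. unif_triangle"
    using prob_space_unif_triangle by (simp add: product_sigma_finite_def prob_space_imp_sigma_finite)
  let ?I = "I - {i}"
  let ?F = "\<lambda>x. indicator {x. first_vertex I i x} x * vertex_weight z (x ` I)"
  have I': "finite ?I" "i \<notin> ?I" "insert i ?I = I" "card ?I = m" using I by auto
  have F[measurable]: "?F \<in> borel_measurable (iid_triangle I)"
  proof -
    note [measurable] = pred_first_vertex[OF I(1,2)]
    have [measurable]: "(\<lambda>x. vertex_weight z (x ` I)) \<in> borel_measurable (iid_triangle I)"
      using measurable_vertex_weight[of I "{}" "\<lambda>i x. x i" "iid_triangle I" z] I(1) by (simp cong: measurable_cong_sets)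
    show ?thesis by measurable
  qed
  have F': "?F \<in> borel_measurable (iid_triangle (insert i ?I))" using F I'(3) by simp
  have K: "(\<lambda>y. \<integral>\<^sup>+x. ?F (x(i := y)) \<partial>iid_triangle ?I) \<in> borel_measurable unif_triangle"
  proof -
    interpret S: finite_product_sigma_finite "\<lambda>_. unif_triangle" ?I by standard (rule I')
    note [measurable] = F'
    show ?thesis by measurable
  qed
  have inner: "(\<integral>\<^sup>+x. ?F (x(i := (u * r, 1 - r))) \<partial>iid_triangle ?I)
    = ennreal z * (\<Sum>j\<le>m. of_nat (m choose j) * (ennreal ((1 - u) * r) ^ (m - j) * ennreal ((1 - u) * (1 - r)) ^ j * ennreal (g j)))"
    if u: "u \<in> {0<..<1}" and r: "r \<in> {0<..<1}" for u r
  proof -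
    have ur: "0 < u" "u < 1" "0 < r" "r < 1" using u r by auto
    define W where "W = {q \<in> open_triangle. u * (1 - snd q) < fst q}"
    define E where "E = chain_map u r -` open_triangle"
    have E: "E \<in> sets unif_triangle" using measurable_sets[OF measurable_chain_map sets_open_triangle, of u r] by (simp add: E_def)
    have W: "W \<in> sets unif_triangle" by (simp add: W_def)
    have B: "chain_map u r \<in> measurable unif_triangle unif_triangle" by (simp cong: measurable_cong_sets)
    have \<Phi>: "(\<lambda>x. vertex_weight z (P \<union> (\<lambda>i. y i x) ` S)) \<in> borel_measurable N"
      if "finite S" "finite P" "\<And>i. i \<in> S \<Longrightarrow> y i \<in> measurable N unif_triangle"
      for S P N and y :: "nat \<Rightarrow> (nat \<Rightarrow> real \<times> real) \<Rightarrow> real \<times> real"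
      using that by (intro measurable_vertex_weight) (auto cong: measurable_cong_sets)
    have "(\<integral>\<^sup>+x. ?F (x(i := (u * r, 1 - r))) \<partial>iid_triangle ?I)
       = (\<integral>\<^sup>+x. ennreal z * thinned (vertex_weight z) (W - E) E (chain_map u r) {} ?I x \<partial>iid_triangle ?I)"
      unfolding W_def E_def by (simp only: vertex_weight_first_vertex[OF ur z I(1,2)])
    also have "\<dots> = ennreal z * (\<integral>\<^sup>+x. thinned (vertex_weight z) (W - E) E (chain_map u r) {} ?I x \<partial>iid_triangle ?I)"
      by (rule nn_integral_cmult, rule measurable_thinned) (use E W I' B \<Phi> in auto)
    also have "(\<integral>\<^sup>+x. thinned (vertex_weight z) (W - E) E (chain_map u r) {} ?I x \<partial>iid_triangle ?I)
       = (\<Sum>S\<in>Pow ?I. emeasure unif_triangle (W - E) ^ (card ?I - card S) * ennreal ((1 - u) * (1 - r)) ^ card S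
            * (\<integral>\<^sup>+x. vertex_weight z ({} \<union> x ` S) \<partial>iid_triangle S))"
    proof (rule nn_integral_thinned)
      show "sigma_finite_measure unif_triangle" using prob_space_unif_triangle by (rule prob_space_imp_sigma_finite)
      show "(\<integral>\<^sup>+q. indicator E q * f (chain_map u r q) \<partial>unif_triangle) = ennreal ((1 - u) * (1 - r)) * (\<integral>\<^sup>+q. f q \<partial>unif_triangle)"
        if "f \<in> borel_measurable unif_triangle" for f
      proof -
        have "indicator E q = (indicator open_triangle (chain_map u r q) :: ennreal)" for q by (simp add: E_def split: split_indicator)
        then show ?thesis using nn_integral_unif_triangle_chain_map[of f u r] that ur by (simp cong: measurable_cong_sets)
      qed
    qed (use E W I' B \<Phi> in auto)
    also have "\<dots> = (\<Sum>S\<in>Pow ?I. ennreal ((1 - u) * r) ^ (m - card S) * ennreal ((1 - u) * (1 - r)) ^ card S * ennreal (g (card S)))"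
    proof (rule sum.cong)
      fix S assume "S \<in> Pow ?I"
      then have "S \<subseteq> ?I" by simp
      from g(2)[OF this] show "emeasure unif_triangle (W - E) ^ (card ?I - card S) * ennreal ((1 - u) * (1 - r)) ^ card S
            * (\<integral>\<^sup>+x. vertex_weight z ({} \<union> x ` S) \<partial>iid_triangle S) = ennreal ((1 - u) * r) ^ (m - card S) * ennreal ((1 - u) * (1 - r)) ^ card S * ennreal (g (card S))"
        using emeasure_unif_triangle_shielded[OF ur] I'(4) by (simp add: W_def E_def)
    qed simp
    also have "\<dots> = (\<Sum>j\<le>m. of_nat (m choose j) * (ennreal ((1 - u) * r) ^ (m - j) * ennreal ((1 - u) * (1 - r)) ^ j * ennreal (g j)))"
      using sum_Pow_card[OF I'(1), of "\<lambda>j. ennreal ((1 - u) * r) ^ (m - j) * ennreal ((1 - u) * (1 - r)) ^ j * ennreal (g j)"] I'(4) by simp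
    finally show ?thesis .
  qed
  have "(\<integral>\<^sup>+x. ?F x \<partial>iid_triangle I) = (\<integral>\<^sup>+y. \<integral>\<^sup>+x. ?F (x(i := y)) \<partial>iid_triangle ?I \<partial>unif_triangle)"
    using product_nn_integral_insert_rev[OF I'(1,2) F'] I'(3) by simp
  also have "\<dots> = (\<integral>\<^sup>+r. indicator {0<..<1} r * (ennreal (2 * r) * (\<integral>\<^sup>+u. indicator {0<..<1} u * (\<integral>\<^sup>+x. ?F (x(i := (u * r, 1 - r))) \<partial>iid_triangle ?I) \<partial>lborel)) \<partial>lborel)"
    by (rule nn_integral_unif_triangle) (use K in \<open>simp cong: measurable_cong_sets\<close>)
  also have "\<dots> = (\<integral>\<^sup>+r. indicator {0<..<1} r * (ennreal (2 * r) * (\<integral>\<^sup>+u. indicator {0<..<1} u *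
      (ennreal z * (\<Sum>j\<le>m. of_nat (m choose j) * (ennreal ((1 - u) * r) ^ (m - j) * ennreal ((1 - u) * (1 - r)) ^ j * ennreal (g j)))) \<partial>lborel)) \<partial>lborel)"
  proof (rule nn_integral_cong)
    fix r :: real
    show "indicator {0<..<1} r * (ennreal (2 * r) * (\<integral>\<^sup>+u. indicator {0<..<1} u * (\<integral>\<^sup>+x. ?F (x(i := (u * r, 1 - r))) \<partial>iid_triangle ?I) \<partial>lborel))
      = indicator {0<..<1} r * (ennreal (2 * r) * (\<integral>\<^sup>+u. indicator {0<..<1} u *
      (ennreal z * (\<Sum>j\<le>m. of_nat (m choose j) * (ennreal ((1 - u) * r) ^ (m - j) * ennreal ((1 - u) * (1 - r)) ^ j * ennreal (g j)))) \<partial>lborel))"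
    proof (cases "r \<in> {0<..<1}")
      case True
      have "indicator {0<..<1} u * (\<integral>\<^sup>+x. ?F (x(i := (u * r, 1 - r))) \<partial>iid_triangle ?I)
        = indicator {0<..<1} u * (ennreal z * (\<Sum>j\<le>m. of_nat (m choose j) * (ennreal ((1 - u) * r) ^ (m - j) * ennreal ((1 - u) * (1 - r)) ^ j * ennreal (g j))))" for u :: real
        using inner[OF _ True, of u] by (cases "u \<in> {0<..<1}") (simp_all only: indicator_simps mult_zero_left mult_1 simp_thms)
      then show ?thesis by (simp only:)
    qed simp
  qed
  also have "\<dots> = ennreal (2 * z / (real (m + 1) * (real (m + 1) * real (m + 2))) * (\<Sum>j\<le>m. real (Suc m - j) * g j))"
    by (rule chain_integral[OF g(1) z])
  finally show ?thesis .
qed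

lemma nverts_empty: "nverts {} = 2"
proof -
  have "\<exists>c :: real \<times> real. \<forall>q \<in> {(1, 0), (0, 1)} - {(1, 0)}. c \<bullet> q < c \<bullet> (1, 0)" by (rule exI[of _ "(1, 0)"]) auto
  moreover have "\<exists>c :: real \<times> real. \<forall>q \<in> {(1, 0), (0, 1)} - {(0, 1)}. c \<bullet> q < c \<bullet> (0, 1)" by (rule exI[of _ "(0, 1)"]) auto
  ultimately have "exposed_points {(1, 0), (0, 1) :: real \<times> real} = {(1, 0), (0, 1)}"
    unfolding exposed_points_def by blast
  then show ?thesis by (simp add: nverts_def)
qed

text \<open>The events that a given point is the first vertex are disjoint, and the preceding integral for
\<open>z = 1\<close> gives each of them the probability \<open>1 / card I\<close>. Hence they exhaust the probability
space up to a null set, which contains all configurations with ties.\<close>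
lemma first_vertex_AE:
  assumes I: "finite I" "I \<noteq> {}"
  shows "AE x in iid_triangle I. \<exists>i\<in>I. first_vertex I i x"
proof -
  interpret product_prob_space "\<lambda>_. unif_triangle" I
    using prob_space_unif_triangle by (auto simp: product_prob_space_def product_sigma_finite_def product_prob_space_axioms_def prob_space_imp_sigma_finite)
  obtain m where m: "card I = Suc m" using I by (metis card_gt_0_iff gr0_conv_Suc)
  let ?A = "\<lambda>i. {x \<in> space (iid_triangle I). first_vertex I i x}"
  have A[measurable]: "?A i \<in> sets (iid_triangle I)" if "i \<in> I" for i
    using pred_first_vertex[OF I(1) that] by (simp add: pred_def)
  have one: "(\<integral>\<^sup>+x. vertex_weight 1 (x ` S) \<partial>iid_triangle S) = ennreal 1" for S
    using prob_space.emeasure_space_1[OF prob_space_iid_triangle] by (simp add: vertex_weight_def)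
  have "emeasure (iid_triangle I) (?A i) = ennreal (1 / real (Suc m))" if i: "i \<in> I" for i
  proof -
    have "emeasure (iid_triangle I) (?A i) = (\<integral>\<^sup>+x. indicator (?A i) x \<partial>iid_triangle I)" using A[OF i] by simp
    also have "\<dots> = (\<integral>\<^sup>+x. indicator {x. first_vertex I i x} x * vertex_weight 1 (x ` I) \<partial>iid_triangle I)"
      by (rule nn_integral_cong) (simp add: vertex_weight_def split: split_indicator)
    also have "\<dots> = ennreal (2 * 1 / (real (m + 1) * (real (m + 1) * real (m + 2))) * (\<Sum>j\<le>m. real (Suc m - j) * 1))"
      by (rule nn_integral_first_vertex[OF I(1) i m]) (simp, simp, rule one)
    also have "2 * 1 / (real (m + 1) * (real (m + 1) * real (m + 2))) * (\<Sum>j\<le>m. real (Suc m - j) * 1)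
        = chain_gf 1 (Suc m) / real (Suc m)"
      by (simp only: chain_gf.simps(2) chain_gf_one) simp
    finally show ?thesis by simp
  qed
  then have "(\<Sum>i\<in>I. emeasure (iid_triangle I) (?A i)) = (\<Sum>i\<in>I. ennreal (1 / real (Suc m)))" by simp
  also have "\<dots> = ennreal (\<Sum>i\<in>I. 1 / real (Suc m))" by (rule sum_ennreal) simp
  also have "(\<Sum>i\<in>I. 1 / real (Suc m)) = 1" by (simp add: m del: of_nat_Suc)
  also have "(\<Sum>i\<in>I. emeasure (iid_triangle I) (?A i)) = emeasure (iid_triangle I) (\<Union>i\<in>I. ?A i)"
    by (rule sum_emeasure) (use A I first_vertex_unique in \<open>auto simp: disjoint_family_on_def\<close>)
  finally have "emeasure (iid_triangle I) (\<Union>i\<in>I. ?A i) = 1" by simp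
  then have "AE x in iid_triangle I. x \<in> (\<Union>i\<in>I. ?A i)"
    using A I by (intro P.AE_in_set_eq_1[THEN iffD2]) (auto simp: measure_def)
  then show ?thesis by eventually_elim auto
qed

lemma nn_integral_vertex_weight:
  assumes "finite I" and z: "z > 0"
  shows "(\<integral>\<^sup>+x. vertex_weight z (x ` I) \<partial>iid_triangle I) = ennreal (chain_gf z (card I))"
  using assms(1)
proof (induction "card I" arbitrary: I rule: less_induct)
  case less
  show ?case
  proof (cases "I = {}")
    case True
    then show ?thesis
      using prob_space.emeasure_space_1[OF prob_space_iid_triangle] by (simp add: vertex_weight_def nverts_empty)
  next
    case False
    then obtain m where m: "card I = Suc m" using less by (metis card_gt_0_iff gr0_conv_Suc)
    let ?F = "\<lambda>i x. indicator {x. first_vertex I i x} x * vertex_weight z (x ` I)"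
    have [measurable]: "?F i \<in> borel_measurable (iid_triangle I)" if "i \<in> I" for i
    proof -
      note [measurable] = pred_first_vertex[OF less.prems that]
      have [measurable]: "(\<lambda>x. vertex_weight z (x ` I)) \<in> borel_measurable (iid_triangle I)"
        using measurable_vertex_weight[of I "{}" "\<lambda>i x. x i" "iid_triangle I" z] less.prems by (simp cong: measurable_cong_sets)
      show ?thesis by measurable
    qed
    have "(\<integral>\<^sup>+x. vertex_weight z (x ` I) \<partial>iid_triangle I) = (\<integral>\<^sup>+x. (\<Sum>i\<in>I. ?F i x) \<partial>iid_triangle I)"
    proof (rule nn_integral_cong_AE)
      show "AE x in iid_triangle I. vertex_weight z (x ` I) = (\<Sum>i\<in>I. ?F i x)"
        using first_vertex_AE[OF less.prems False]
      proof eventually_elim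
        case (elim x)
        then obtain i where i: "i \<in> I" "first_vertex I i x" by blast
        have "(\<Sum>i\<in>I. ?F i x) = (\<Sum>j\<in>{i}. ?F j x)"
          by (rule sum.mono_neutral_right) (use i less.prems first_vertex_unique in \<open>auto split: split_indicator\<close>)
        then show ?case using i by simp
      qed
    qed
    also have "\<dots> = (\<Sum>i\<in>I. \<integral>\<^sup>+x. ?F i x \<partial>iid_triangle I)" by (rule nn_integral_sum) simp
    also have "\<dots> = (\<Sum>i\<in>I. ennreal (chain_gf z (Suc m) / real (Suc m)))"
    proof (rule sum.cong)
      fix i assume i: "i \<in> I"
      have "(\<integral>\<^sup>+x. ?F i x \<partial>iid_triangle I)
        = ennreal (2 * z / (real (m + 1) * (real (m + 1) * real (m + 2))) * (\<Sum>j\<le>m. real (Suc m - j) * chain_gf z j))"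
      proof (rule nn_integral_first_vertex[OF less.prems i m z])
        show "chain_gf z j \<ge> 0" for j using chain_gf_pos[OF z, of j] by simp
        fix S assume S: "S \<subseteq> I - {i}"
        then have "S \<subset> I" using i by auto
        then have "card S < card I" "finite S" using less.prems by (auto intro: psubset_card_mono finite_subset)
        then show "(\<integral>\<^sup>+x. vertex_weight z (x ` S) \<partial>iid_triangle S) = ennreal (chain_gf z (card S))" by (rule less.hyps)
      qed
      also have "2 * z / (real (m + 1) * (real (m + 1) * real (m + 2))) * (\<Sum>j\<le>m. real (Suc m - j) * chain_gf z j) = chain_gf z (Suc m) / real (Suc m)"
        by (simp only: chain_gf.simps(2)) simp
      finally show "(\<integral>\<^sup>+x. ?F i x \<partial>iid_triangle I) = ennreal (chain_gf z (Suc m) / real (Suc m))" .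
    qed simp
    also have "\<dots> = ennreal (\<Sum>i\<in>I. chain_gf z (Suc m) / real (Suc m))"
      by (rule sum_ennreal) (use chain_gf_pos[OF z, of "Suc m"] in auto)
    also have "(\<Sum>i\<in>I. chain_gf z (Suc m) / real (Suc m)) = chain_gf z (card I)" by (simp add: m del: of_nat_Suc)
    finally show ?thesis .
  qed
qed

section \<open>Asymptotics of the generating function\<close>

lemma chain_gf_Suc_0: "chain_gf z (Suc 0) = z ^ 3"
  by (simp add: chain_gf.simps(2) power3_eq_cube power2_eq_square)

text \<open>Second differences of the convolution with the linear weights \<open>n - j\<close>.\<close>
lemma chain_gf_three_term:
  fixes n :: nat and z :: real
  defines "k \<equiv> real n"
  shows "(k + 2) * (k + 3) * chain_gf z (Suc (Suc n))
     = (2 * (k + 1) * (k + 2) + 2 * z) * chain_gf z (Suc n) - k * (k + 1) * chain_gf z n"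
proof -
  have W: "(real m + 1) * (real m + 2) * chain_gf z (Suc m) = 2 * z * (\<Sum>j\<le>m. real (Suc m - j) * chain_gf z j)" for m
  proof -
    have "a * (b / a * t) = b * t" if "a \<noteq> 0" for a b t :: real using that by simp
    from this[of "(real m + 1) * (real m + 2)"] show ?thesis
      by (simp add: chain_gf.simps(2) add.commute)
  qed
  have S: "(\<Sum>j\<le>Suc m. real (Suc (Suc m) - j) * chain_gf z j)
     = (\<Sum>j\<le>m. real (Suc m - j) * chain_gf z j) + (\<Sum>j\<le>Suc m. chain_gf z j)" for m
  proof -
    have "(\<Sum>j\<le>m. real (Suc (Suc m) - j) * chain_gf z j) = (\<Sum>j\<le>m. real (Suc m - j) * chain_gf z j + chain_gf z j)"
      by (rule sum.cong) (auto simp: Suc_diff_le algebra_simps)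
    then show ?thesis by (simp add: sum.distrib)
  qed
  show ?thesis
  proof (cases n)
    case 0
    then show ?thesis using W[of 0] W[of 1] by (simp add: k_def S field_simps)
  next
    case (Suc m)
    have 1: "(k + 2) * (k + 3) * chain_gf z (Suc (Suc n)) = (k + 1) * (k + 2) * chain_gf z (Suc n) + 2 * z * (\<Sum>j\<le>Suc n. chain_gf z j)"
      using W[of "Suc n"] W[of n] S[of n] by (simp add: k_def algebra_simps)
    have 2: "(k + 1) * (k + 2) * chain_gf z (Suc n) = k * (k + 1) * chain_gf z n + 2 * z * (\<Sum>j\<le>n. chain_gf z j)"
      using W[of n] W[of m] S[of m] Suc by (simp add: k_def algebra_simps)
    show ?thesis using 1 2 by (simp add: algebra_simps)
  qed
qed

text \<open>Both sequences of bounds are compatible with the three-term recurrence in the form of a map from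
one quotient of successive terms to the next one. This map is increasing, so it suffices that
\<open>1 + p / (n + 1)\<close> is a subsolution and \<open>1 / (1 - p / (n + 1))\<close> a supersolution; each is off by a
nonnegative multiple of \<open>p\<^sup>2 (1 + p)\<close>.\<close>
lemma chain_gf_ratio_bounds:
  fixes p :: real
  assumes p: "\<bar>p\<bar> < 1" and z: "2 * z = (1 + p) * (2 + p)"
  shows "(1 + p / (real n + 2)) * chain_gf z (Suc n) \<le> chain_gf z (Suc (Suc n))"
    and "(1 - p / (real n + 2)) * chain_gf z (Suc (Suc n)) \<le> chain_gf z (Suc n)"
proof -
  have zpos: "z > 0" using p z by (smt (verit) mult_pos_pos)
  let ?g = "chain_gf z"
  have gp: "?g m > 0" for m using chain_gf_pos[OF zpos] .
  have "(real n + 2 + p) * ?g (Suc n) \<le> (real n + 2) * ?g (Suc (Suc n)) \<and>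
        (real n + 2 - p) * ?g (Suc (Suc n)) \<le> (real n + 2) * ?g (Suc n)"
  proof (induction n)
    case 0
    have e: "6 * ?g 2 = (4 + 2 * z) * ?g 1" using chain_gf_three_term[of 0 z] by (simp add: numeral_2_eq_2)
    have g2: "?g 2 = (1 + p / 2 + p^2 / 6) * ?g 1" using e z by (simp add: power2_eq_square) algebra
    have "(2 - p) * (1 + p / 2 + p^2 / 6) - 2 = - (p^2 * (1 + p)) / 6" by (simp add: power2_eq_square field_simps)
    also have "\<dots> \<le> 0" using p by auto
    finally have "(2 - p) * (1 + p / 2 + p^2 / 6) \<le> 2" by simp
    from mult_right_mono[OF this, of "?g 1"] have b: "(2 - p) * ?g 2 \<le> 2 * ?g 1" using g2 gp[of 1] by (simp add: mult.assoc)
    have "2 + p \<le> 2 * (1 + p / 2 + p^2 / 6)" by simp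
    from mult_right_mono[OF this, of "?g 1"] have a: "(2 + p) * ?g 1 \<le> 2 * ?g 2" using g2 gp[of 1] by (simp add: mult.assoc)
    show ?case using a b by (simp add: numeral_2_eq_2)
  next
    case (Suc n)
    define k where "k = real n"
    define a b c where "a = ?g (Suc n)" and "b = ?g (Suc (Suc n))" and "c = ?g (Suc (Suc (Suc n)))"
    have k0: "k \<ge> 0" and pos: "a > 0" "b > 0" "c > 0" by (auto simp: k_def a_def b_def c_def gp)
    have rec: "(k + 3) * (k + 4) * c = (2 * (k + 2) * (k + 3) + 2 * z) * b - (k + 1) * (k + 2) * a"
      using chain_gf_three_term[of "Suc n" z] by (simp add: k_def a_def b_def c_def add_ac)
    have lo: "(k + 2 + p) * a \<le> (k + 2) * b" and up: "(k + 2 - p) * b \<le> (k + 2) * a"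
      using Suc by (auto simp: k_def a_def b_def)
    have "(k + 3 + p) * b \<le> (k + 3) * c"
    proof -
      have "(k+2+p) * ((k + 4) * ((k + 3 + p) * b)) \<le> (k+2+p) * ((k+4) * ((k + 3) * c))"
      proof -
        have "(k+2+p) * ((k+4) * ((k + 3) * c)) = (k+2+p) * (2 * (k + 2) * (k + 3) + 2 * z) * b - (k + 1) * (k + 2) * ((k+2+p) * a)"
        proof -
          have "(k+2+p) * ((k+4) * ((k + 3) * c)) = (k+2+p) * ((k + 3) * (k + 4) * c)" by simp
          then show ?thesis unfolding rec by (simp only: algebra_simps)
        qed
        also have "\<dots> \<ge> (k+2+p) * (2 * (k + 2) * (k + 3) + 2 * z) * b - (k + 1) * (k + 2) * ((k+2) * b)"
          using mult_left_mono[OF lo, of "(k+1)*(k+2)"] k0 by simp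
        also have "(k+2+p) * (2 * (k + 2) * (k + 3) + 2 * z) * b - (k + 1) * (k + 2) * ((k+2) * b) - (k+2+p) * ((k + 4) * ((k + 3 + p) * b))
           = p\<^sup>2 * (1 + p) * b"
          unfolding z by (simp add: algebra_simps power2_eq_square)
        moreover have "p\<^sup>2 * (1 + p) * b \<ge> 0" using p pos by simp
        ultimately show ?thesis by linarith
      qed
      then show ?thesis using k0 p by (simp add: mult_le_cancel_left)
    qed
    moreover have "(k + 3 - p) * c \<le> (k + 3) * b"
    proof -
      have "(k+2) * ((k+4) * ((k+3) * ((k + 3 - p) * c))) \<le> (k+2) * ((k+4) * ((k+3) * ((k + 3) * b)))"
      proof -
        have "(k+2) * ((k+4) * ((k+3) * ((k + 3 - p) * c))) = (k + 3 - p) * (k+2) * ((2 * (k + 2) * (k + 3) + 2 * z) * b) - (k+3-p) * (k + 1) * (k + 2) * ((k+2) * a)"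
        proof -
          have "(k+2) * ((k+4) * ((k+3) * ((k + 3 - p) * c))) = (k+2) * (k + 3 - p) * ((k + 3) * (k + 4) * c)" by simp
          then show ?thesis unfolding rec by (simp only: algebra_simps)
        qed
        also have "\<dots> \<le> (k + 3 - p) * (k+2) * ((2 * (k + 2) * (k + 3) + 2 * z) * b) - (k+3-p) * (k + 1) * (k + 2) * ((k+2-p) * b)"
          using mult_left_mono[OF up, of "(k+3-p)*(k+1)*(k+2)"] k0 p by simp
        also have "(k+2) * ((k+4) * ((k+3) * ((k + 3) * b))) - ((k + 3 - p) * (k+2) * ((2 * (k + 2) * (k + 3) + 2 * z) * b) - (k+3-p) * (k + 1) * (k + 2) * ((k+2-p) * b))
            = (k + 2) * p\<^sup>2 * (1 + p) * b"
          unfolding z by (simp add: algebra_simps power2_eq_square)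
        moreover have "(k + 2) * p\<^sup>2 * (1 + p) * b \<ge> 0" using p pos k0 by simp
        ultimately show ?thesis by linarith
      qed
      then show ?thesis using k0 p by (simp add: mult_le_cancel_left)
    qed
    ultimately show ?case by (simp add: k_def b_def c_def algebra_simps)
  qed
  then show "(1 + p / (real n + 2)) * ?g (Suc n) \<le> ?g (Suc (Suc n))"
    and "(1 - p / (real n + 2)) * ?g (Suc (Suc n)) \<le> ?g (Suc n)"
    by (auto simp: field_simps)
qed

text \<open>The logarithms of the quotients differ from \<open>p (ln (n + 1) - ln n)\<close> by at most
\<open>2 (1/n - 1/(n + 1))\<close>, and these errors telescope.\<close>
lemma ln_chain_gf_bound:
  fixes p :: real
  assumes p: "\<bar>p\<bar> \<le> 1/2" and z: "2 * z = (1 + p) * (2 + p)"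
  shows "\<bar>ln (chain_gf z (Suc n)) - 3 * ln z - p * ln (real (Suc n))\<bar> \<le> 2 * (1 - 1 / real (Suc n))"
proof -
  have "(1 + p) * (2 + p) > 0" by (rule mult_pos_pos) (use p in auto)
  then have zpos: "z > 0" using z by simp
  show ?thesis
  proof (induction n)
    case 0
    show ?case using zpos by (simp add: chain_gf_Suc_0 ln_realpow)
  next
    case (Suc n)
    let ?g = "chain_gf z"
    define k where "k = real n"
    have k0: "k \<ge> 0" by (simp add: k_def)
    have gp: "?g m > 0" for m using chain_gf_pos[OF zpos] .
    define r where "r = ln (?g (Suc (Suc n))) - ln (?g (Suc n))"
    define x where "x = p / (k + 2)"
    have x: "\<bar>x\<bar> \<le> 1/2" "x\<^sup>2 \<le> (1/4) / (k+2)^2"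
    proof -
      have "\<bar>x\<bar> = \<bar>p\<bar> / (k + 2)" using k0 by (simp add: x_def abs_divide)
      also have "\<dots> \<le> (1/2) / (k + 2)" by (rule divide_right_mono) (use p k0 in auto)
      also have "\<dots> \<le> 1/2" using k0 by (simp add: field_simps)
      finally show "\<bar>x\<bar> \<le> 1/2" .
      have "p\<^sup>2 \<le> (1/2)\<^sup>2" using p by (metis abs_ge_zero power2_abs power_mono)
      then have "p\<^sup>2 \<le> 1/4" by (simp add: power2_eq_square)
      then show "x\<^sup>2 \<le> (1/4) / (k+2)^2" unfolding x_def power_divide
        by (rule divide_right_mono) auto
    qed
    have p1: "\<bar>p\<bar> < 1" using p by auto
    have "ln (1 + x) + ln (?g (Suc n)) \<le> ln (?g (Suc (Suc n)))"
    proof -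
      have "(1 + x) * ?g (Suc n) \<le> ?g (Suc (Suc n))"
        using chain_gf_ratio_bounds(1)[OF p1 z, of n] by (simp add: x_def k_def)
      moreover have "1 + x > 0" using x by auto
      ultimately show ?thesis using gp by (metis ln_le_cancel_iff ln_mult_pos mult_pos_pos)
    qed
    then have lo: "r \<ge> ln (1 + x)" by (simp add: r_def)
    have "ln (1 - x) + ln (?g (Suc (Suc n))) \<le> ln (?g (Suc n))"
    proof -
      have "(1 - x) * ?g (Suc (Suc n)) \<le> ?g (Suc n)"
        using chain_gf_ratio_bounds(2)[OF p1 z, of n] by (simp add: x_def k_def)
      moreover have "1 - x > 0" using x by auto
      ultimately show ?thesis using gp by (metis ln_le_cancel_iff ln_mult_pos mult_pos_pos)
    qed
    then have up: "r \<le> - ln (1 - x)" by (simp add: r_def)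
    have "\<bar>ln (1 + x) - x\<bar> \<le> 2 * x\<^sup>2" "\<bar>ln (1 + -x) - (-x)\<bar> \<le> 2 * (-x)\<^sup>2"
      using x by (intro abs_ln_one_plus_x_minus_x_bound; simp)+
    with lo up have rx: "\<bar>r - x\<bar> \<le> 2 * x\<^sup>2" by simp
    also have "\<dots> \<le> (1/2) / (k+2)^2" using x by simp
    also have "\<dots> = 1 / (2 * (k+2)^2)" by simp
    also have "\<dots> \<le> 1 / ((k+1)*(k+2))"
    proof (rule frac_le)
      have "0 \<le> k * k" by simp
      then show "(k+1)*(k+2) \<le> 2 * (k+2)^2" using k0 unfolding power2_eq_square by (simp only: algebra_simps)
    qed (use k0 in auto)
    finally have r1: "\<bar>r - x\<bar> \<le> 1 / ((k+1)*(k+2))" .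
    define d where "d = ln (k + 2) - ln (k + 1)"
    have d1: "d \<le> 1 / (k+1)" and d2: "d \<ge> 1 / (k+2)"
    proof -
      have "d = ln ((k+2)/(k+1))" using k0 by (simp add: d_def ln_div)
      also have "(k+2)/(k+1) = 1 + 1/(k+1)" using k0 by (simp add: field_simps)
      finally have "d = ln (1 + 1/(k+1))" .
      then show "d \<le> 1/(k+1)" using ln_add_one_self_le_self[of "1/(k+1)"] k0 by simp
      have "- d = ln ((k+1)/(k+2))" using k0 by (simp add: d_def ln_div)
      also have "(k+1)/(k+2) = 1 + (-1/(k+2))" using k0 by (simp add: field_simps)
      also have "ln (1 + (-1/(k+2))) \<le> -1/(k+2)" by (rule ln_add_one_self_le_self2) (use k0 in \<open>simp add: field_simps\<close>)
      finally show "d \<ge> 1 / (k+2)" by simp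
    qed
    have "1/(k+1) - 1/(k+2) = 1 / ((k+1)*(k+2))" using k0 by (simp add: field_simps)
    then have dd: "\<bar>1/(k+2) - d\<bar> \<le> 1 / ((k+1)*(k+2))" using d1 d2 by linarith
    have "\<bar>x - p * d\<bar> = \<bar>p\<bar> * \<bar>1/(k+2) - d\<bar>" unfolding abs_mult[symmetric] by (simp add: x_def algebra_simps)
    also have "\<dots> \<le> 1 * \<bar>1/(k+2) - d\<bar>" by (rule mult_right_mono) (use p in auto)
    finally have "\<bar>x - p * d\<bar> \<le> 1 / ((k+1)*(k+2))" using dd by simp
    with r1 have "\<bar>r - p * d\<bar> \<le> 2 * (1 / ((k+1)*(k+2)))" by linarith
    also have "1 / ((k+1)*(k+2)) = 1/(k+1) - 1/(k+2)" using k0 by (simp add: field_simps)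
    finally have "\<bar>r - p * d\<bar> \<le> 2 * (1/(k+1) - 1/(k+2))" .
    moreover have "\<bar>ln (?g (Suc n)) - 3 * ln z - p * ln (k+1)\<bar> \<le> 2 * (1 - 1 / (k+1))"
      using Suc.IH by (simp add: k_def add.commute)
    ultimately have "\<bar>ln (?g (Suc (Suc n))) - 3 * ln z - p * ln (k+2)\<bar> \<le> 2 * (1 - 1 / (k+2))"
      unfolding r_def d_def by (simp add: algebra_simps)
    then show ?case by (simp add: k_def add.commute)
  qed
qed

lemma exponent_expansion:
  "((\<lambda>\<theta>::real. ((sqrt (1 + 8 * exp \<theta>) - 3) / 2 - 2/3 * \<theta>) / \<theta>\<^sup>2) \<longlongrightarrow> 5/27) (at 0)"
  by real_asymp

text \<open>A bounded error in the logarithm vanishes after division by \<open>s\<close>, however slowly \<open>s\<close> grows, and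
the linear term of the exponent is cancelled by the centring; so only its quadratic coefficient
\<open>5/27\<close> is left.\<close>
lemma ln_chain_gf_asymp:
  fixes \<theta> :: "nat \<Rightarrow> real" and s :: "nat \<Rightarrow> real"
  assumes th: "\<theta> \<longlonglongrightarrow> 0" and nz: "eventually (\<lambda>n. \<theta> n \<noteq> 0) sequentially"
    and s: "filterlim s at_top sequentially"
    and lim: "(\<lambda>n. (\<theta> n)\<^sup>2 * ln (real n) / s n) \<longlonglongrightarrow> c"
  shows "(\<lambda>n. (ln (chain_gf (exp (\<theta> n)) n) - 2/3 * \<theta> n * ln (real n)) / s n) \<longlonglongrightarrow> 5/27 * c"
proof -
  define p where "p = (\<lambda>\<theta>::real. (sqrt (1 + 8 * exp \<theta>) - 3) / 2)"
  have pz: "2 * exp t = (1 + p t) * (2 + p t)" for t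
  proof -
    have "(sqrt (1 + 8 * exp t))\<^sup>2 = 1 + 8 * exp t" by (rule real_sqrt_pow2) (simp add: add_nonneg_nonneg)
    then show ?thesis unfolding p_def by (simp add: field_simps power2_eq_square)
  qed
  have pc: "(p \<longlongrightarrow> p 0) (at 0)" unfolding p_def by (intro tendsto_intros) auto
  have "filterlim \<theta> (at 0) sequentially" using th nz by (auto simp: filterlim_at)
  note fl = this
  have "p 0 = 0" by (simp add: p_def)
  then have "(\<lambda>n. p (\<theta> n)) \<longlonglongrightarrow> 0" using filterlim_compose[OF pc fl] by simp
  then have ev1: "eventually (\<lambda>n. \<bar>p (\<theta> n)\<bar> < 1/2) sequentially" by (auto dest: tendstoD[of _ _ _ "1/2"] simp: dist_real_def)
  have ev2: "eventually (\<lambda>n. \<bar>\<theta> n\<bar> < 1) sequentially" using tendstoD[OF th, of 1] by (simp add: dist_real_def)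
  have s0: "eventually (\<lambda>n. s n > 0) sequentially" using s by (simp add: filterlim_at_top_dense)
  define e where "e n = (ln (chain_gf (exp (\<theta> n)) n) - p (\<theta> n) * ln (real n)) / s n" for n
  have "e \<longlonglongrightarrow> 0"
  proof (rule tendsto_0_le[where f = "\<lambda>n. 1 / s n" and K = 5])
    show "(\<lambda>n. 1 / s n) \<longlonglongrightarrow> 0" using s by (rule tendsto_divide_0[OF tendsto_const filterlim_at_top_imp_at_infinity])
    show "\<forall>\<^sub>F n in sequentially. norm (e n) \<le> norm (1 / s n) * 5"
      using ev1 ev2 s0 eventually_gt_at_top[of 0]
    proof eventually_elim
      case (elim n)
      obtain m where m: "n = Suc m" using elim gr0_conv_Suc by auto
      have "\<bar>ln (chain_gf (exp (\<theta> n)) n) - 3 * ln (exp (\<theta> n)) - p (\<theta> n) * ln (real n)\<bar> \<le> 2 * (1 - 1 / real n)"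
        unfolding m using elim m by (intro ln_chain_gf_bound pz) auto
      also have "\<dots> \<le> 2" using elim by simp
      finally have "\<bar>ln (chain_gf (exp (\<theta> n)) n) - p (\<theta> n) * ln (real n)\<bar> \<le> 5" using elim by simp
      then show ?case using elim by (simp add: e_def abs_divide divide_right_mono)
    qed
  qed
  moreover have "(\<lambda>n. (p (\<theta> n) - 2/3 * \<theta> n) / (\<theta> n)\<^sup>2 * ((\<theta> n)\<^sup>2 * ln (real n) / s n)) \<longlonglongrightarrow> 5/27 * c"
  proof (intro tendsto_mult lim filterlim_compose[OF _ fl])
    show "((\<lambda>t. (p t - 2/3 * t) / t\<^sup>2) \<longlongrightarrow> 5/27) (at 0)" unfolding p_def by (rule exponent_expansion)
  qed
  ultimately have "(\<lambda>n. e n + (p (\<theta> n) - 2/3 * \<theta> n) / (\<theta> n)\<^sup>2 * ((\<theta> n)\<^sup>2 * ln (real n) / s n)) \<longlonglongrightarrow> 0 + 5/27 * c"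
    by (rule tendsto_add)
  moreover have "\<forall>\<^sub>F n in sequentially. e n + (p (\<theta> n) - 2/3 * \<theta> n) / (\<theta> n)\<^sup>2 * ((\<theta> n)\<^sup>2 * ln (real n) / s n)
      = (ln (chain_gf (exp (\<theta> n)) n) - 2/3 * \<theta> n * ln (real n)) / s n"
    using nz s0 by eventually_elim (simp add: e_def field_simps)
  ultimately show ?thesis by (simp add: tendsto_cong)
qed

section \<open>Large deviations from a quadratic limit of the cumulant generating functions\<close>

lemma good_rate_function_quadratic: "good_rate_function (\<lambda>x. ereal (x\<^sup>2 / 2))"
  unfolding good_rate_function_def lower_semicontinuous_def
proof (intro conjI allI impI)
  fix x :: real
  have "((\<lambda>y. ereal (y\<^sup>2 / 2)) \<longlongrightarrow> ereal (x\<^sup>2 / 2)) (at x)" by (intro tendsto_intros) auto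
  then have "Liminf (at x) (\<lambda>y. ereal (y\<^sup>2 / 2)) = ereal (x\<^sup>2 / 2)" by (rule lim_imp_Liminf[rotated]) simp
  then show "ereal (x\<^sup>2 / 2) \<le> Liminf (at x) (\<lambda>y. ereal (y\<^sup>2 / 2))" by simp
next
  fix c :: real assume c: "c \<ge> 0"
  have "x\<^sup>2 / 2 \<le> c \<longleftrightarrow> x \<in> cball 0 (sqrt (2 * c))" for x
  proof -
    have "x\<^sup>2 / 2 \<le> c \<longleftrightarrow> x\<^sup>2 \<le> 2 * c" by linarith
    also have "\<dots> \<longleftrightarrow> \<bar>x\<bar> \<le> sqrt (2 * c)" using real_sqrt_le_iff[of "x\<^sup>2" "2 * c"] by simp
    finally show ?thesis by simp
  qed
  then have "{x. ereal (x\<^sup>2 / 2) \<le> ereal c} = cball 0 (sqrt (2 * c))"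
    by (simp only: ereal_less_eq(3)) blast
  then show "compact {x. ereal (x\<^sup>2 / 2) \<le> ereal c}" by simp
qed auto

text \<open>Chernoff's bound under an exponentially tilted measure. The parameter \<open>\<eta>\<close> may have either sign,
which covers both tails.\<close>
lemma (in prob_space) exponential_tail_bound:
  fixes Y :: "'a \<Rightarrow> real" and s l \<eta> t :: real
  assumes Y[measurable]: "Y \<in> borel_measurable M" and s: "s \<ge> 0"
    and int: "\<And>l. integrable M (\<lambda>\<omega>. exp (l * s * Y \<omega>))"
  shows "(\<integral>\<omega>. exp (l * s * Y \<omega>) * indicator {\<omega> \<in> space M. \<eta> * t \<le> \<eta> * Y \<omega>} \<omega> \<partial>M)
    \<le> exp (- \<eta> * s * t) * (\<integral>\<omega>. exp ((l + \<eta>) * s * Y \<omega>) \<partial>M)"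
proof -
  have "(\<integral>\<omega>. exp (l * s * Y \<omega>) * indicator {\<omega> \<in> space M. \<eta> * t \<le> \<eta> * Y \<omega>} \<omega> \<partial>M)
      \<le> (\<integral>\<omega>. exp (- \<eta> * s * t) * exp ((l + \<eta>) * s * Y \<omega>) \<partial>M)"
  proof (rule integral_mono)
    show "integrable M (\<lambda>\<omega>. exp (l * s * Y \<omega>) * indicator {\<omega> \<in> space M. \<eta> * t \<le> \<eta> * Y \<omega>} \<omega>)"
      by (intro integrable_real_mult_indicator int) simp
    show "integrable M (\<lambda>\<omega>. exp (- \<eta> * s * t) * exp ((l + \<eta>) * s * Y \<omega>))"
      by (intro integrable_mult_right int)
    fix \<omega>
    have "exp (l * s * Y \<omega>) \<le> exp (- \<eta> * s * t) * exp ((l + \<eta>) * s * Y \<omega>)" if "\<eta> * t \<le> \<eta> * Y \<omega>"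
      using mult_left_mono[OF that s] unfolding exp_add[symmetric] by (simp add: algebra_simps)
    then show "exp (l * s * Y \<omega>) * indicator {\<omega> \<in> space M. \<eta> * t \<le> \<eta> * Y \<omega>} \<omega>
        \<le> exp (- \<eta> * s * t) * exp ((l + \<eta>) * s * Y \<omega>)"
      by (simp split: split_indicator)
  qed
  then show ?thesis by simp
qed

lemma ln_ext_le:
  assumes s: "s > 0" and p: "p \<ge> 0" "p \<le> exp (s * c)"
  shows "ereal (1 / s) * ln_ext p \<le> ereal c"
proof (cases "p = 0")
  case False
  then have "ln p \<le> ln (exp (s * c))" using p by (subst ln_le_cancel_iff) auto
  then have "ln p / s \<le> c" using s by (simp add: pos_divide_le_eq mult.commute)
  then show ?thesis using False by (simp add: ln_ext_def)
qed (use s in \<open>simp add: ln_ext_def\<close>)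

lemma ln_ext_ge:
  assumes s: "s > 0" and p: "exp (s * c) \<le> p"
  shows "ereal c \<le> ereal (1 / s) * ln_ext p"
proof -
  have p0: "p > 0" using p by (rule order_less_le_trans[rotated]) simp
  then have "ln (exp (s * c)) \<le> ln p" using p by (subst ln_le_cancel_iff) auto
  then have "c \<le> ln p / s" using s by (simp add: pos_le_divide_eq mult.commute)
  then show ?thesis using p0 by (simp add: ln_ext_def)
qed

text \<open>The theorem of Gaertner and Ellis for the limit \<open>l\<^sup>2 / 2\<close>, which is its own Legendre transform.
The upper bound needs only the two tails beyond the distance of the set from the origin. For the
lower bound near \<open>x\<close>, tilting with the parameter \<open>x\<close> moves the mass to \<open>x\<close>: the tilted mass
outside \<open>(x - d, x + d)\<close> is exponentially smaller, by a factor of order \<open>exp (- s d\<^sup>2 / 2)\<close>, and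
inside the interval the tilting costs \<open>exp (s (x\<^sup>2 + \<bar>x\<bar> d))\<close> at most.\<close>
lemma (in prob_space) gaertner_ellis_quadratic:
  fixes Y :: "nat \<Rightarrow> 'a \<Rightarrow> real" and s :: "nat \<Rightarrow> real"
  assumes Y[measurable]: "\<And>n. Y n \<in> borel_measurable M"
    and s: "\<And>n. s n \<ge> 0" "filterlim s at_top sequentially"
    and int: "\<And>l n. integrable M (\<lambda>\<omega>. exp (l * s n * Y n \<omega>))"
    and lim: "\<And>l. (\<lambda>n. ln (\<integral>\<omega>. exp (l * s n * Y n \<omega>) \<partial>M) / s n) \<longlonglongrightarrow> l\<^sup>2 / 2"
  shows "large_deviation_principle M Y s (\<lambda>x. ereal (x\<^sup>2 / 2))"
proof -
  define m where "m l n = (\<integral>\<omega>. exp (l * s n * Y n \<omega>) \<partial>M)" for l n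
  define P where "P B n = measure M {\<omega> \<in> space M. Y n \<omega> \<in> B}" for B n
  define F where "F B n = ereal (1 / s n) * ln_ext (P B n)" for B n
  have sev: "\<forall>\<^sub>F n in sequentially. s n > C" for C using s(2) by (simp add: filterlim_at_top_dense)
  have m_pos: "m l n > 0" for l n
  proof -
    have "m l n \<noteq> 0"
    proof
      assume "m l n = 0"
      then have "AE \<omega> in M. exp (l * s n * Y n \<omega>) = 0"
        unfolding m_def by (subst (asm) integral_nonneg_eq_0_iff_AE[OF int]) auto
      then have "AE \<omega> in M. False" by simp
      then show False using AE_False by blast
    qed
    moreover have "m l n \<ge> 0" unfolding m_def by simp
    ultimately show ?thesis by simp
  qed
  have m_ev: "\<forall>\<^sub>F n in sequentially. exp (s n * (l\<^sup>2 / 2 - e)) \<le> m l n \<and> m l n \<le> exp (s n * (l\<^sup>2 / 2 + e))"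
    if "e > 0" for l e
    using tendstoD[OF lim[of l] that] sev[of 0]
  proof eventually_elim
    case (elim n)
    then have "\<bar>ln (m l n) / s n - l\<^sup>2 / 2\<bar> < e" by (simp add: dist_real_def m_def)
    then have "l\<^sup>2 / 2 - e \<le> ln (m l n) / s n" "ln (m l n) / s n \<le> l\<^sup>2 / 2 + e" by linarith+
    then have "s n * (l\<^sup>2 / 2 - e) \<le> ln (m l n)" "ln (m l n) \<le> s n * (l\<^sup>2 / 2 + e)"
      by (simp_all only: pos_le_divide_eq[OF elim(2)] pos_divide_le_eq[OF elim(2)] mult.commute)
    then have "exp (s n * (l\<^sup>2 / 2 - e)) \<le> exp (ln (m l n))" "exp (ln (m l n)) \<le> exp (s n * (l\<^sup>2 / 2 + e))"
      by (simp_all only: exp_le_cancel_iff)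
    then show ?case by (simp only: exp_ln[OF m_pos])
  qed
  have int_ind: "integrable M (indicator A :: _ \<Rightarrow> real)" if "A \<in> sets M" for A
    by (rule integrable_real_indicator) (simp_all add: that emeasure_eq_measure)
  have PE: "P B n = (\<integral>\<omega>. indicator {\<omega> \<in> space M. Y n \<omega> \<in> B} \<omega> \<partial>M)" if "B \<in> sets borel" for B n
  proof -
    have [measurable]: "B \<in> sets borel" by fact
    show ?thesis unfolding P_def by simp
  qed
  have upper: "limsup (F B) \<le> ereal (- (d\<^sup>2 / 2))" if B[measurable]: "B \<in> sets borel" and d: "\<And>y. y \<in> B \<Longrightarrow> d \<le> \<bar>y\<bar>" "d \<ge> 0" for B d
  proof (rule ereal_le_epsilon2)
    fix e :: real assume e: "e > 0"
    have e2: "e / 2 > 0" using e by simp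
    have "\<forall>\<^sub>F n in sequentially. F B n \<le> ereal (- (d\<^sup>2 / 2) + e)"
      using m_ev[OF e2, of d] m_ev[OF e2, of "- d"] sev[of 0] sev[of "2 * ln 2 / e"]
    proof eventually_elim
      case (elim n)
      let ?A = "\<lambda>\<eta>. {\<omega> \<in> space M. \<eta> * \<eta> \<le> \<eta> * Y n \<omega>}"
      have "P B n \<le> (\<integral>\<omega>. exp (0 * s n * Y n \<omega>) * indicator (?A d) \<omega> + exp (0 * s n * Y n \<omega>) * indicator (?A (-d)) \<omega> \<partial>M)"
        unfolding PE[OF B]
      proof (rule integral_mono)
        fix \<omega> assume "\<omega> \<in> space M"
        have "\<omega> \<in> ?A d \<or> \<omega> \<in> ?A (-d)" if yB: "Y n \<omega> \<in> B"
        proof -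
          consider "d \<le> Y n \<omega>" | "d \<le> - Y n \<omega>" using d(1)[OF yB] by linarith
          then have "d * d \<le> d * Y n \<omega> \<or> d * d \<le> d * (- Y n \<omega>)"
            using d(2) mult_left_mono[of d _ d] by cases blast+
          then show ?thesis using \<open>\<omega> \<in> space M\<close> by auto
        qed
        then show "(indicator {\<omega> \<in> space M. Y n \<omega> \<in> B} \<omega> :: real) \<le> exp (0 * s n * Y n \<omega>) * indicator (?A d) \<omega> + exp (0 * s n * Y n \<omega>) * indicator (?A (-d)) \<omega>"
          by (auto split: split_indicator)
      next
        show "integrable M (indicator {\<omega> \<in> space M. Y n \<omega> \<in> B} :: _ \<Rightarrow> real)" by (rule int_ind) simp
        show "integrable M (\<lambda>\<omega>. exp (0 * s n * Y n \<omega>) * indicator (?A d) \<omega> + exp (0 * s n * Y n \<omega>) * indicator (?A (-d)) \<omega>)"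
          by (intro Bochner_Integration.integrable_add integrable_real_mult_indicator int) simp_all
      qed
      also have "\<dots> = (\<integral>\<omega>. exp (0 * s n * Y n \<omega>) * indicator (?A d) \<omega> \<partial>M) + (\<integral>\<omega>. exp (0 * s n * Y n \<omega>) * indicator (?A (-d)) \<omega> \<partial>M)"
        by (rule Bochner_Integration.integral_add; intro integrable_real_mult_indicator int; simp)
      also have "\<dots> \<le> exp (- d * s n * d) * m (0 + d) n + exp (- (- d) * s n * (- d)) * m (0 + (- d)) n"
        unfolding m_def by (intro add_mono exponential_tail_bound s int Y)
      also have "\<dots> \<le> exp (- d * s n * d) * exp (s n * (d\<^sup>2 / 2 + e / 2)) + exp (- d * s n * d) * exp (s n * (d\<^sup>2 / 2 + e / 2))"
      proof (intro add_mono)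
        show "exp (- d * s n * d) * m (0 + d) n \<le> exp (- d * s n * d) * exp (s n * (d\<^sup>2 / 2 + e / 2))"
          by (rule mult_left_mono) (use elim in simp_all)
        have "exp (- (- d) * s n * - d) * m (0 + - d) n \<le> exp (- (- d) * s n * - d) * exp (s n * (d\<^sup>2 / 2 + e / 2))"
          by (rule mult_left_mono) (use elim in simp_all)
        then show "exp (- (- d) * s n * - d) * m (0 + - d) n \<le> exp (- d * s n * d) * exp (s n * (d\<^sup>2 / 2 + e / 2))"
          by simp
      qed
      also have "\<dots> = exp (ln 2) * exp (s n * (- (d\<^sup>2 / 2) + e / 2))"
        unfolding exp_add[symmetric] by (simp add: algebra_simps power2_eq_square exp_diff exp_add)
      also have "\<dots> \<le> exp (s n * (- (d\<^sup>2 / 2) + e))"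
        using elim e unfolding exp_add[symmetric] by (simp add: field_simps)
      finally show ?case unfolding F_def using elim by (intro ln_ext_le) (auto simp: P_def)
    qed
    then show "limsup (F B) \<le> ereal (- (d\<^sup>2 / 2)) + ereal e" by (simp add: Limsup_bounded)
  qed
  have lower: "ereal (- (x\<^sup>2 / 2)) \<le> liminf (F B)" if B[measurable]: "B \<in> sets borel" and x: "x \<in> interior B" for B x
  proof (rule ereal_le_epsilon2)
    fix e :: real assume e: "e > 0"
    obtain d0 where d0: "d0 > 0" "ball x d0 \<subseteq> B" using x by (meson mem_interior)
    define d where "d = min d0 (min 1 (e / (2 * (\<bar>x\<bar> + 1))))"
    have d: "d > 0" "d \<le> d0" "d \<le> 1" using d0 e by (auto simp: d_def)
    have "d * (\<bar>x\<bar> + 1) \<le> e / (2 * (\<bar>x\<bar> + 1)) * (\<bar>x\<bar> + 1)"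
      by (rule mult_right_mono) (auto simp: d_def)
    also have "\<dots> = e / 2"
    proof -
      have "e / (2 * c) * c = e / 2" if "c > 0" for c using that by simp
      moreover have "\<bar>x\<bar> + 1 > 0" by simp
      ultimately show ?thesis by blast
    qed
    finally have dx: "d * (\<bar>x\<bar> + 1) \<le> e / 2" .
    have dd: "d\<^sup>2 \<le> d" using d by (simp add: power2_eq_square mult_left_le)
    \<comment> \<open>The tilted tails have the exponent \<open>x\<^sup>2 / 2 - d\<^sup>2 / 2 + g = x\<^sup>2 / 2 - 3 g\<close>, below \<open>x\<^sup>2 / 2 - g\<close>.\<close>
    define g where "g = d\<^sup>2 / 8"
    have g: "g > 0" using d by (simp add: g_def)
    have "\<forall>\<^sub>F n in sequentially. ereal (- (x\<^sup>2 / 2) - e) \<le> F B n"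
      using m_ev[OF g, of x] m_ev[OF g, of "x + d"] m_ev[OF g, of "x - d"] sev[of 0] sev[of "2 * ln 2 / (2 * g)"] sev[of "2 * ln 2 / e"]
    proof eventually_elim
      case (elim n)
      let ?S = "s n"
      let ?A = "\<lambda>\<eta> t. {\<omega> \<in> space M. \<eta> * t \<le> \<eta> * Y n \<omega>}"
      let ?B = "{\<omega> \<in> space M. Y n \<omega> \<in> B}"
      let ?e = "\<lambda>\<omega>. exp (x * ?S * Y n \<omega>)"
      have i: "integrable M (\<lambda>\<omega>. ?e \<omega> * indicator (?A \<eta> t) \<omega>)" for \<eta> t
        by (intro integrable_real_mult_indicator int) simp
      have i': "integrable M (\<lambda>\<omega>. exp (?S * (x\<^sup>2 + \<bar>x\<bar> * d)) * indicator ?B \<omega> :: real)"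
        by (intro integrable_mult_right int_ind) simp
      have "m x n \<le> (\<integral>\<omega>. exp (?S * (x\<^sup>2 + \<bar>x\<bar> * d)) * indicator ?B \<omega> + (?e \<omega> * indicator (?A d (x + d)) \<omega> + ?e \<omega> * indicator (?A (-d) (x - d)) \<omega>) \<partial>M)"
        unfolding m_def
      proof (rule integral_mono)
        fix \<omega> assume w: "\<omega> \<in> space M"
        consider "x + d \<le> Y n \<omega>" | "Y n \<omega> \<le> x - d" | "\<bar>Y n \<omega> - x\<bar> < d" by linarith
        then show "?e \<omega> \<le> exp (?S * (x\<^sup>2 + \<bar>x\<bar> * d)) * indicator ?B \<omega> + (?e \<omega> * indicator (?A d (x + d)) \<omega> + ?e \<omega> * indicator (?A (-d) (x - d)) \<omega>)"
        proof cases
          case 1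
          then have "\<omega> \<in> ?A d (x + d)" using w d by (simp add: mult_left_mono)
          then show ?thesis by (simp split: split_indicator)
        next
          case 2
          then have "\<omega> \<in> ?A (-d) (x - d)" using w d by (simp add: mult_left_mono)
          then show ?thesis by (simp split: split_indicator)
        next
          case 3
          have "dist x (Y n \<omega>) < d0" using 3 d by (simp add: dist_real_def)
          then have "\<omega> \<in> ?B" using w d0 by auto
          moreover have "x * (Y n \<omega> - x) \<le> \<bar>x\<bar> * d"
            by (rule order_trans[OF abs_ge_self]) (use 3 in \<open>auto simp: abs_mult intro!: mult_left_mono\<close>)
          then have "?S * (x * Y n \<omega>) \<le> ?S * (x\<^sup>2 + \<bar>x\<bar> * d)" using s(1)[of n]
            by (intro mult_left_mono) (auto simp: algebra_simps power2_eq_square)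
          then have "?e \<omega> \<le> exp (?S * (x\<^sup>2 + \<bar>x\<bar> * d))" by (simp add: mult_ac)
          ultimately show ?thesis by (simp add: add_increasing2 split: split_indicator)
        qed
      qed (intro int Bochner_Integration.integrable_add i i')+
      also have "\<dots> = (\<integral>\<omega>. exp (?S * (x\<^sup>2 + \<bar>x\<bar> * d)) * indicator ?B \<omega> \<partial>M)
          + ((\<integral>\<omega>. ?e \<omega> * indicator (?A d (x + d)) \<omega> \<partial>M) + (\<integral>\<omega>. ?e \<omega> * indicator (?A (-d) (x - d)) \<omega> \<partial>M))"
        by (simp only: Bochner_Integration.integral_add[OF i' Bochner_Integration.integrable_add[OF i i]] Bochner_Integration.integral_add[OF i i])
      also have "(\<integral>\<omega>. exp (?S * (x\<^sup>2 + \<bar>x\<bar> * d)) * indicator ?B \<omega> \<partial>M) = exp (?S * (x\<^sup>2 + \<bar>x\<bar> * d)) * P B n"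
        unfolding PE[OF B] by simp
      also have "(\<integral>\<omega>. ?e \<omega> * indicator (?A d (x + d)) \<omega> \<partial>M) + (\<integral>\<omega>. ?e \<omega> * indicator (?A (-d) (x - d)) \<omega> \<partial>M)
          \<le> exp (- d * ?S * (x + d)) * m (x + d) n + exp (- (- d) * ?S * (x - d)) * m (x + (- d)) n"
        unfolding m_def by (intro add_mono exponential_tail_bound s int Y)
      also have "\<dots> \<le> exp (- d * ?S * (x + d)) * exp (?S * ((x + d)\<^sup>2 / 2 + g)) + exp (d * ?S * (x - d)) * exp (?S * ((x - d)\<^sup>2 / 2 + g))"
        using elim by (auto intro!: add_mono mult_left_mono)
      also have "\<dots> = exp (ln 2) * exp (?S * (x\<^sup>2 / 2 - 3 * g))"
      proof -
        have "- d * ?S * (x + d) + ?S * ((x + d)\<^sup>2 / 2 + g) = ?S * (x\<^sup>2 / 2 - 3 * g)"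
          "d * ?S * (x - d) + ?S * ((x - d)\<^sup>2 / 2 + g) = ?S * (x\<^sup>2 / 2 - 3 * g)"
          unfolding g_def by (simp_all add: power2_eq_square field_simps)
        then show ?thesis by (simp add: exp_add[symmetric])
      qed
      also have "\<dots> \<le> exp (- ln 2) * exp (?S * (x\<^sup>2 / 2 - g))"
        using elim g unfolding exp_add[symmetric] by (simp add: field_simps)
      also have "\<dots> \<le> exp (- ln 2) * m x n" using elim by simp
      also have "exp (- ln 2) * m x n = m x n / 2" by (simp add: exp_minus)
      finally have "m x n / 2 \<le> exp (?S * (x\<^sup>2 + \<bar>x\<bar> * d)) * P B n" by simp
      moreover have "exp (?S * (x\<^sup>2 / 2 - g)) / 2 \<le> m x n / 2" using elim by simp
      ultimately have "exp (- ln 2) * exp (?S * (x\<^sup>2 / 2 - g)) \<le> exp (?S * (x\<^sup>2 + \<bar>x\<bar> * d)) * P B n" by (simp add: exp_minus)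
      then have "exp (- (?S * (x\<^sup>2 + \<bar>x\<bar> * d))) * (exp (- ln 2) * exp (?S * (x\<^sup>2 / 2 - g))) \<le> exp (- (?S * (x\<^sup>2 + \<bar>x\<bar> * d))) * (exp (?S * (x\<^sup>2 + \<bar>x\<bar> * d)) * P B n)"
        by (rule mult_left_mono) simp
      then have "exp (- (?S * (x\<^sup>2 + \<bar>x\<bar> * d)) + (- ln 2 + ?S * (x\<^sup>2 / 2 - g))) \<le> P B n"
        unfolding mult.assoc[symmetric] exp_add[symmetric] by (simp add: add.assoc)
      moreover have "- (?S * (x\<^sup>2 + \<bar>x\<bar> * d)) + (- ln 2 + ?S * (x\<^sup>2 / 2 - g)) = - ln 2 - ?S * (x\<^sup>2 / 2 + g + \<bar>x\<bar> * d)"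
      proof -
        have "?S * (x\<^sup>2 + \<bar>x\<bar> * d) = ?S * (x\<^sup>2 / 2 - g) + ?S * (x\<^sup>2 / 2 + g + \<bar>x\<bar> * d)"
          unfolding distrib_left[symmetric] by simp
        then show ?thesis by linarith
      qed
      ultimately have PB: "exp (- ln 2 - ?S * (x\<^sup>2 / 2 + g + \<bar>x\<bar> * d)) \<le> P B n" by metis
      have "g + \<bar>x\<bar> * d \<le> e / 2" using dx dd d unfolding g_def by (simp add: algebra_simps)
      then have "?S * (x\<^sup>2 / 2 + g + \<bar>x\<bar> * d) \<le> ?S * (x\<^sup>2 / 2 + e / 2)" using s(1)[of n] by (intro mult_left_mono) auto
      moreover have "ln 2 \<le> ?S * (e / 2)" using elim e by (simp add: field_simps)
      ultimately have "?S * (- (x\<^sup>2 / 2) - e) \<le> - ln 2 - ?S * (x\<^sup>2 / 2 + g + \<bar>x\<bar> * d)" by (simp add: algebra_simps)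
      then have "exp (?S * (- (x\<^sup>2 / 2) - e)) \<le> P B n" using PB by (meson exp_le_cancel_iff order_trans)
      then show ?case unfolding F_def using elim by (intro ln_ext_ge) auto
    qed
    then have "ereal (- (x\<^sup>2 / 2) - e) \<le> liminf (F B)" by (rule Liminf_bounded)
    then show "ereal (- (x\<^sup>2 / 2)) \<le> liminf (F B) + ereal e"
      by (simp add: ereal_minus_le[symmetric])
  qed
  have "- (INF x\<in>interior B. ereal (x\<^sup>2 / 2)) \<le> liminf (F B) \<and> liminf (F B) \<le> limsup (F B) \<and>
      limsup (F B) \<le> - (INF x\<in>closure B. ereal (x\<^sup>2 / 2))" if B: "B \<in> sets borel" for B
  proof (intro conjI)
    have "(INF x\<in>interior B. ereal (x\<^sup>2 / 2)) \<ge> - liminf (F B)"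
      by (rule INF_greatest) (subst ereal_uminus_le_reorder, simp only: uminus_ereal.simps lower[OF B])
    then show "- (INF x\<in>interior B. ereal (x\<^sup>2 / 2)) \<le> liminf (F B)" by (simp add: ereal_uminus_le_reorder)
    show "liminf (F B) \<le> limsup (F B)" by (rule Liminf_le_Limsup) simp
    show "limsup (F B) \<le> - (INF x\<in>closure B. ereal (x\<^sup>2 / 2))"
    proof (cases "B = {}")
      case True
      have "\<forall>\<^sub>F n in sequentially. F B n \<le> - \<infinity>"
        using sev[of 0] by eventually_elim (simp add: F_def P_def ln_ext_def True)
      then have "limsup (F B) \<le> - \<infinity>" by (rule Limsup_bounded)
      then show ?thesis using True by (simp add: top_ereal_def)
    next
      case False
      then obtain x where x: "x \<in> closure B" "\<And>y. y \<in> closure B \<Longrightarrow> dist 0 x \<le> dist 0 y"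
        using distance_attains_inf[of "closure B" 0] by auto
      have "limsup (F B) \<le> ereal (- (\<bar>x\<bar>\<^sup>2 / 2))"
        by (rule upper[OF B]) (use x(2) closure_subset in \<open>auto simp: dist_real_def\<close>)
      also have "\<dots> = - ereal (x\<^sup>2 / 2)" by simp
      also have "\<dots> \<le> - (INF x\<in>closure B. ereal (x\<^sup>2 / 2))"
        unfolding ereal_minus_le_minus by (rule INF_lower) (rule x)
      finally show ?thesis .
    qed
  qed
  then show ?thesis
    unfolding large_deviation_principle_def F_def P_def
    using Y s good_rate_function_quadratic by blast
qed

section \<open>The moderate deviation principle\<close>

lemma num_vertices_T_hull: "num_vertices (T_hull X n \<omega>) = nverts ((\<lambda>i. X i \<omega>) ` {1..n})"
  unfolding num_vertices_def T_hull_def nverts_def triangle_v1_def triangle_v2_def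
  by (subst extreme_points_finite_hull) simp_all

lemma measurable_num_vertices_T_hull:
  assumes "\<And>i. i \<ge> 1 \<Longrightarrow> X i \<in> borel_measurable M"
  shows "(\<lambda>\<omega>. num_vertices (T_hull X n \<omega>)) \<in> measurable M (count_space UNIV)"
proof -
  have "(\<lambda>\<omega>. nverts ({} \<union> (\<lambda>i. X i \<omega>) ` {1..n})) \<in> measurable M (count_space UNIV)"
    by (rule measurable_nverts) (auto intro: assms)
  then show ?thesis by (simp add: num_vertices_T_hull)
qed

text \<open>Independence and the uniform marginals identify the law of the sample with the product measure,
where the generating function has been computed.\<close>
lemma (in prob_space) expectation_power_num_vertices:
  fixes X :: "nat \<Rightarrow> 'a \<Rightarrow> real \<times> real"
  assumes indep: "indep_vars (\<lambda>_. borel) X {1..}"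
    and unif: "\<And>i. i \<ge> 1 \<Longrightarrow> distr M borel (X i) = uniform_measure lborel triangle_T"
    and z: "z > 0"
  shows "integrable M (\<lambda>\<omega>. z ^ num_vertices (T_hull X n \<omega>))"
    and "expectation (\<lambda>\<omega>. z ^ num_vertices (T_hull X n \<omega>)) = chain_gf z n"
proof -
  let ?f = "\<lambda>\<omega>. z ^ num_vertices (T_hull X n \<omega>)"
  have rv: "X i \<in> borel_measurable M" if "i \<ge> 1" for i using indep that by (auto simp: indep_vars_def)
  note [measurable] = measurable_num_vertices_T_hull[of X M n, OF rv]
  have nn: "(\<integral>\<^sup>+\<omega>. ennreal (?f \<omega>) \<partial>M) = ennreal (chain_gf z n)"
  proof (cases "n = 0")
    case True
    then show ?thesis by (simp add: num_vertices_T_hull nverts_empty emeasure_space_1)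
  next
    case False
    let ?I = "{1..n}"
    have "indep_vars (\<lambda>_. borel) X ?I" by (rule indep_vars_subset[OF indep]) auto
    then have "distr M (PiM ?I (\<lambda>_. borel)) (\<lambda>\<omega>. \<lambda>i\<in>?I. X i \<omega>) = PiM ?I (\<lambda>i. distr M borel (X i))"
      by (subst (asm) indep_vars_iff_distr_eq_PiM') (use False rv in auto)
    also have "\<dots> = iid_triangle ?I"
      by (rule PiM_cong) (simp_all add: unif unif_triangle_def)
    finally have D: "iid_triangle ?I = distr M (PiM ?I (\<lambda>_. borel)) (\<lambda>\<omega>. \<lambda>i\<in>?I. X i \<omega>)" ..
    have "ennreal (chain_gf z n) = (\<integral>\<^sup>+x. vertex_weight z (x ` ?I) \<partial>iid_triangle ?I)"
      using nn_integral_vertex_weight[of ?I z] z by simp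
    also have "\<dots> = (\<integral>\<^sup>+\<omega>. vertex_weight z ((\<lambda>i\<in>?I. X i \<omega>) ` ?I) \<partial>M)"
    proof -
      have "(\<lambda>\<omega>. \<lambda>i\<in>?I. X i \<omega>) \<in> measurable M (PiM ?I (\<lambda>_. borel))"
        by (rule measurable_restrict) (auto intro: rv)
      moreover have "(\<lambda>x. vertex_weight z (x ` ?I)) \<in> borel_measurable (PiM ?I (\<lambda>_. borel))"
        using measurable_vertex_weight[of ?I "{}" "\<lambda>i x. x i" "PiM ?I (\<lambda>_. borel)" z] by simp
      ultimately show ?thesis unfolding D by (intro nn_integral_distr) simp_all
    qed
    also have "\<dots> = (\<integral>\<^sup>+\<omega>. ennreal (?f \<omega>) \<partial>M)"
      by (rule nn_integral_cong) (simp add: vertex_weight_def num_vertices_T_hull)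
    finally show ?thesis ..
  qed
  show int: "integrable M ?f"
    by (rule integrableI_nonneg) (use z nn in auto)
  have "expectation ?f = enn2real (\<integral>\<^sup>+\<omega>. ennreal (?f \<omega>) \<partial>M)"
    by (rule integral_eq_nn_integral) (use z in auto)
  then show "expectation ?f = chain_gf z n" using chain_gf_pos[OF z, of n] by (simp add: nn)
qed

theorem theorem3p7:
  fixes M :: "'w measure"
    and X :: "nat \<Rightarrow> 'w \<Rightarrow> real \<times> real"
    and a :: "nat \<Rightarrow> real"
  assumes "prob_space M"
    and "prob_space.indep_vars M (\<lambda>_. borel) X {1..}"
    and "\<And>i. i \<ge> 1 \<Longrightarrow> distr M borel (X i) = uniform_measure lborel triangle_T"
    and "\<And>n. n \<ge> 1 \<Longrightarrow> a n > 0"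
    and "filterlim a at_top sequentially"
    and "(\<lambda>n. a n / sqrt (ln (real n))) \<longlonglongrightarrow> 0"
  shows "large_deviation_principle M (Y_rescaled a X) (\<lambda>n. (a n)\<^sup>2) (\<lambda>x. ereal (x\<^sup>2 / 2))"
proof -
  interpret prob_space M by (rule assms(1))
  let ?N = "\<lambda>n \<omega>. num_vertices (T_hull X n \<omega>)"
  define \<kappa> :: real where "\<kappa> = sqrt (10 / 27)"
  define \<theta> where "\<theta> l n = l / \<kappa> * (a n / sqrt (ln (real n)))" for l n
  have \<kappa>: "\<kappa> > 0" "\<kappa>\<^sup>2 = 10 / 27" by (auto simp: \<kappa>_def)
  note pgf = expectation_power_num_vertices[OF assms(2,3) exp_gt_zero]
  \<comment> \<open>For \<open>a n = 0\<close> or \<open>n < 2\<close> both exponents are 0 by the conventions on division.\<close>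
  have tilt: "exp (l * (a n)\<^sup>2 * Y_rescaled a X n \<omega>) = exp (\<theta> l n) ^ ?N n \<omega> * exp (- (2/3 * \<theta> l n * ln (real n)))" for l n \<omega>
  proof -
    have "l * (a n)\<^sup>2 * Y_rescaled a X n \<omega> = \<theta> l n * (real (?N n \<omega>) - 2/3 * ln (real n))"
      by (cases "a n = 0") (simp_all add: Y_rescaled_def \<theta>_def \<kappa>_def power2_eq_square)
    also have "\<dots> = real (?N n \<omega>) * \<theta> l n + - (2/3 * \<theta> l n * ln (real n))" by (simp add: algebra_simps)
    finally show ?thesis by (simp only: exp_add exp_of_nat_mult)
  qed
  have at: "filterlim (\<lambda>n. (a n)\<^sup>2) at_top sequentially"
    by (rule filterlim_pow_at_top) (use assms(5) in auto)
  show ?thesis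
  proof (rule gaertner_ellis_quadratic)
    fix n
    have rv: "X i \<in> borel_measurable M" if "i \<ge> 1" for i using assms(2) that by (auto simp: indep_vars_def)
    note [measurable] = measurable_num_vertices_T_hull[of X M n, OF rv]
    show "Y_rescaled a X n \<in> borel_measurable M" unfolding Y_rescaled_def by measurable
  next
    fix l n
    show "integrable M (\<lambda>\<omega>. exp (l * (a n)\<^sup>2 * Y_rescaled a X n \<omega>))"
      unfolding tilt by (intro integrable_mult_left pgf)
  next
    fix l :: real
    have ln: "ln (\<integral>\<omega>. exp (l * (a n)\<^sup>2 * Y_rescaled a X n \<omega>) \<partial>M) = ln (chain_gf (exp (\<theta> l n)) n) - 2/3 * \<theta> l n * ln (real n)" for n
    proof -
      have "(\<integral>\<omega>. exp (l * (a n)\<^sup>2 * Y_rescaled a X n \<omega>) \<partial>M) = chain_gf (exp (\<theta> l n)) n * exp (- (2/3 * \<theta> l n * ln (real n)))"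
        unfolding tilt by (simp add: pgf)
      then show ?thesis using chain_gf_pos[of "exp (\<theta> l n)" n] by (simp add: ln_mult)
    qed
    show "(\<lambda>n. ln (\<integral>\<omega>. exp (l * (a n)\<^sup>2 * Y_rescaled a X n \<omega>) \<partial>M) / (a n)\<^sup>2) \<longlonglongrightarrow> l\<^sup>2 / 2"
    proof (cases "l = 0")
      case True
      then show ?thesis by (simp add: prob_space)
    next
      case False
      have "\<theta> l \<longlonglongrightarrow> l / \<kappa> * 0" unfolding \<theta>_def by (intro tendsto_mult tendsto_const assms(6))
      then have th: "\<theta> l \<longlonglongrightarrow> 0" by simp
      have pos: "\<forall>\<^sub>F n in sequentially. a n > 0 \<and> ln (real n) > 0"
        using eventually_ge_at_top[of 2] by eventually_elim (use assms(4) in auto)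
      have nz: "\<forall>\<^sub>F n in sequentially. \<theta> l n \<noteq> 0"
        using pos by eventually_elim (use False \<kappa> in \<open>auto simp: \<theta>_def\<close>)
      have "\<forall>\<^sub>F n in sequentially. (\<theta> l n)\<^sup>2 * ln (real n) / (a n)\<^sup>2 = 27 / 10 * l\<^sup>2"
        using pos
      proof eventually_elim
        case (elim n)
        then have "(\<theta> l n)\<^sup>2 = l\<^sup>2 / (10 / 27) * ((a n)\<^sup>2 / ln (real n))"
          by (simp add: \<theta>_def power_mult_distrib power_divide \<kappa>(2))
        then show ?case using elim by simp
      qed
      then have "(\<lambda>n. (\<theta> l n)\<^sup>2 * ln (real n) / (a n)\<^sup>2) \<longlonglongrightarrow> 27 / 10 * l\<^sup>2" by (rule tendsto_eventually)
      from ln_chain_gf_asymp[OF th nz at this] show ?thesis unfolding ln by simp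
    qed
  qed (use at in auto)
qed

end
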